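(* Let $\lambda,\mu$ be Dyck paths of the same length with $\lambda(i)\le\mu(i)$ for all $i$, and let $f_{\lambda/\mu}$ be the recursively defined formal integer linear combination of Dyck tilings of $\lambda/\mu$ given in the context. Then $$f_{\lambda/\mu}=\sum_{\text{cover-inclusive Dyck tilings }\mathcal T\text{ of }\lambda/\mu}\mathcal T ,$$ that is, $f_{\lambda/\mu}$ is a linear combination of only the cover-inclusive Dyck tilings, and each of them has coefficient $1$.
   Context: A Dyck path of length $2n$ is a map $h:\{0,\dots,2n\}\to\{0,1,\dots\}$ with $h(0)=h(2n)=0$ and $|h(i+1)-h(i)|=1$. Its $a$-th step goes from $h(a-1)$ to $h(a)$. A chord of $h$ is a pair $(a,b)$, $a<b$, where step $a$ is an up step and step $b$ is the first later (down) step at which the path returns to height $h(a-1)$ (i.e. a matched pair of parentheses when up/down steps are read as "("/")"). For Dyck paths $\lambda,\mu$ of the same length, write $\mu\subseteq\lambda$ if $\lambda(i)\le\mu(i)$ for all $i$. The skew Young diagram $\lambda/\mu$ is the set of (45-degree rotated) boxes between the lower path $\lambda$ and the upper path $\mu$; identifying a box with its center, it is $\{(i,j)\in\mathbb Z^2: i+j\text{ odd},\ \lambda(i)<j<\mu(i)\}$. A Dyck tile is a set of boxes of the form $\{(a+k,\,b+d(k)):0\le k\le 2m\}$ where $m\ge0$ and $d$ is a Dyck path of length $2m$. Its horizontal extent is the interval $[a,a+2m]$. A Dyck tiling of $\lambda/\mu$ is a partition of its boxes into Dyck tiles. A tile $T$ covers a tile $T'\ne T$ if some box $(i,j)\in T$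 and some box $(i,j')\in T'$ satisfy $j>j'$. A Dyck tiling is cover-inclusive if whenever a tile covers another tile, the horizontal extent of the first is contained in the horizontal extent of the second. Pushing down: for a set $S$ of chords of $\mu$, $\mu\downarrow S$ denotes the path obtained from $\mu$ by reversing, for every chord $(a,b)\in S$, the steps $a$ and $b$ (the up step becomes a down step and vice versa). This corresponds to placing one Dyck tile for each chord of $S$ along the upper boundary $\mu$, longer tiles higher up: the chord $(a,b)\in S$ gives the tile $\{(i,\mu(i)-1-2k): a\le i\le b-1\}$, where $k$ is the number of chords of $S$ strictly enclosing $(a,b)$. Definition of $f_{\lambda/\mu}$: it is the formal integer linear combination of Dyck tilings of $\lambda/\mu$ defined recursively by $f_{\lambda/\mu}=1$ (the empty tiling with coefficient $1$) if $\lambda=\mu$; $f_{\lambda/\rho}=0$ if $\rho\not\subseteq\lambda$ (i.e. if $\rho$ is a path not satisfying $\rho\ge\lambda$ pointwise); and otherwise $$f_{\lambda/\mu}=\sum_{\emptyset\neq S\subseteq\{\text{chords of }\mu\}}(-1)^{1+|S|}\,\bigl(\text{tiles of }S\text{ placed on top of }f_{\lambda/(\mu\downarrow S)}\bigr),$$ where "placed on top" means that the tiles of the chords in $S$ (that is, for each chord $(a,b)\in S$, the tile $\{(i,\mu(i)-1-2k): a\le i\le b-1\}$, where $k$ is the number of chords of $S$ strictly enclosing $(a,b)$) are added to each tiling of $\lambda/(\mu\downarrow S)$ appearing in $f_{\lambda/(\mu\downarrow S)}$, extended linearly. *)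

theory Defs
  imports Main "HOL-Library.Disjoint_Sets" "HOL-Library.Poly_Mapping"
begin

text \<open>
  A path of length \<open>2n\<close> is a function \<open>int \<Rightarrow> int\<close> of which only the values on
  \<open>{0..2n}\<close> are relevant; equality of paths below therefore always means
  equality on that interval.
\<close>

definition dyck_path :: "nat \<Rightarrow> (int \<Rightarrow> int) \<Rightarrow> bool" where
  "dyck_path n h \<longleftrightarrow> h 0 = 0 \<and> h (2 * int n) = 0
     \<and> (\<forall>i\<in>{0..2 * int n}. 0 \<le> h i)
     \<and> (\<forall>i\<in>{0..<2 * int n}. \<bar>h (i + 1) - h i\<bar> = 1)"

definition path_eq :: "nat \<Rightarrow> (int \<Rightarrow> int) \<Rightarrow> (int \<Rightarrow> int) \<Rightarrow> bool" where
  "path_eq n h h' \<longleftrightarrow> (\<forall>i\<in>{0..2 * int n}. h i = h' i)"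

definition path_le :: "nat \<Rightarrow> (int \<Rightarrow> int) \<Rightarrow> (int \<Rightarrow> int) \<Rightarrow> bool" where
  "path_le n h h' \<longleftrightarrow> (\<forall>i\<in>{0..2 * int n}. h i \<le> h' i)"

type_synonym box = "int \<times> int"
type_synonym tile = "box set"

definition skew_boxes :: "nat \<Rightarrow> (int \<Rightarrow> int) \<Rightarrow> (int \<Rightarrow> int) \<Rightarrow> box set" where
  "skew_boxes n l u = {(i, j). i \<in> {0..2 * int n} \<and> odd (i + j) \<and> l i < j \<and> j < u i}"

definition dyck_tile :: "tile \<Rightarrow> bool" where
  "dyck_tile T \<longleftrightarrow> (\<exists>a b m d. dyck_path m d
     \<and> T = (\<lambda>k. (a + k, b + d k)) ` {0..2 * int m})"

definition dyck_tiling :: "nat \<Rightarrow> (int \<Rightarrow> int) \<Rightarrow> (int \<Rightarrow> int) \<Rightarrow> tile set \<Rightarrow> bool" where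
  "dyck_tiling n l u \<T> \<longleftrightarrow> partition_on (skew_boxes n l u) \<T> \<and> (\<forall>T\<in>\<T>. dyck_tile T)"

definition covers :: "tile \<Rightarrow> tile \<Rightarrow> bool" where
  "covers T T' \<longleftrightarrow> T \<noteq> T' \<and> (\<exists>i j j'. (i, j) \<in> T \<and> (i, j') \<in> T' \<and> j > j')"

text \<open>The horizontal extent, as the set of integer points of the interval:\<close>

definition horizontal_extent :: "tile \<Rightarrow> int set" where
  "horizontal_extent T = fst ` T"

lemma horizontal_extent_tile:
  "horizontal_extent ((\<lambda>k. (a + k, b + d k)) ` {0..2 * int m}) = {a..a + 2 * int m}"
  by (auto simp: horizontal_extent_def image_image add.commute)

definition cover_inclusive :: "tile set \<Rightarrow> bool" where
  "cover_inclusive \<T> \<longleftrightarrow> (\<forall>T\<in>\<T>. \<forall>T'\<in>\<T>. covers T T' \<longrightarrow>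
     horizontal_extent T \<subseteq> horizontal_extent T')"

definition chords :: "nat \<Rightarrow> (int \<Rightarrow> int) \<Rightarrow> (int \<times> int) set" where
  "chords n h = {(a, b). 1 \<le> a \<and> a < b \<and> b \<le> 2 * int n
     \<and> h a = h (a - 1) + 1 \<and> h b = h (b - 1) - 1
     \<and> h b = h (a - 1) \<and> (\<forall>c\<in>{a..<b}. h c \<noteq> h (a - 1))}"

definition push_down :: "(int \<Rightarrow> int) \<Rightarrow> (int \<times> int) set \<Rightarrow> int \<Rightarrow> int" where
  "push_down h S i = h 0 + (\<Sum>k\<in>{1..i}.
     if k \<in> fst ` S \<union> snd ` S then - (h k - h (k - 1)) else h k - h (k - 1))"

definition chord_tile :: "(int \<Rightarrow> int) \<Rightarrow> (int \<times> int) set \<Rightarrow> int \<times> int \<Rightarrow> tile" where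
  "chord_tile h S = (\<lambda>(a, b).
     (\<lambda>i. (i, h i - 1 - 2 * int (card {(a', b') \<in> S. a' < a \<and> b < b'}))) ` {a..b - 1})"

lemma finite_chords: "finite (chords n h)"
  by (rule finite_subset[of _ "{1..2 * int n} \<times> {1..2 * int n}"]) (auto simp: chords_def)

lemma inj_on_fst_chords: "inj_on fst (chords n h)"
proof (rule inj_onI)
  fix p q assume "p \<in> chords n h" "q \<in> chords n h" and e: "fst p = fst q"
  then obtain a b b' where p: "p = (a, b)" "q = (a, b')"
    "(a, b) \<in> chords n h" "(a, b') \<in> chords n h"
    by (metis prod.collapse)
  have "\<not> b < b'" "\<not> b' < b"
    using p(3,4) by (auto simp: chords_def)
  then show "p = q" using p(1,2) by simp
qed

lemma inj_on_snd_chords: "inj_on snd (chords n h)"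
proof (rule inj_onI)
  fix p q assume "p \<in> chords n h" "q \<in> chords n h" and e: "snd p = snd q"
  then obtain a a' b where p: "p = (a, b)" "q = (a', b)"
    "(a, b) \<in> chords n h" "(a', b) \<in> chords n h"
    by (metis prod.collapse)
  have "\<not> a < a'"
  proof
    assume "a < a'"
    then have "a' - 1 \<in> {a..<b}" using p(4) by (auto simp: chords_def)
    then show False using p(3,4) by (auto simp: chords_def)
  qed
  moreover have "\<not> a' < a"
  proof
    assume "a' < a"
    then have "a - 1 \<in> {a'..<b}" using p(3) by (auto simp: chords_def)
    then show False using p(3,4) by (auto simp: chords_def)
  qed
  ultimately show "p = q" using p(1,2) by simp
qed

lemma push_down_eq:
  assumes S: "S \<subseteq> chords n h" and i: "0 \<le> i"
  shows "push_down h S i = h i - 2 * int (card {c \<in> S. fst c \<le> i \<and> i < snd c})"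
proof -
  define s where "s k = h k - h (k - 1)" for k
  have fin: "finite S" using S finite_chords finite_subset by blast
  have injf: "inj_on fst S" and injs: "inj_on snd S"
    using S inj_on_fst_chords inj_on_snd_chords inj_on_subset by blast+
  have tel: "(\<Sum>k\<in>{1..i}. s k) = h i - h 0"
    using i
  proof (induction i rule: int_ge_induct)
    case base then show ?case by simp
  next
    case (step i)
    have "{1..i + 1} = insert (i + 1) {1..i}" using step by auto
    then show ?case using step by (simp add: s_def)
  qed
  let ?A = "{c \<in> S. fst c \<le> i}" and ?B = "{c \<in> S. snd c \<le> i}"
  let ?C = "{c \<in> S. fst c \<le> i \<and> i < snd c}"
  let ?K = "{1..i} \<inter> (fst ` S \<union> snd ` S)"
  have sA: "s (fst c) = 1" and sB: "s (snd c) = -1" and lt: "fst c < snd c"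
    and pos: "1 \<le> fst c" if "c \<in> S" for c
    using that S by (auto simp: s_def chords_def)
  have K: "?K = fst ` ?A \<union> snd ` ?B"
    using pos lt by force
  have disj: "fst ` ?A \<inter> snd ` ?B = {}"
  proof (rule ccontr)
    assume "fst ` ?A \<inter> snd ` ?B \<noteq> {}"
    then obtain c c' where "c \<in> S" "c' \<in> S" "fst c = snd c'" by blast
    then show False using sA[of c] sB[of c'] by simp
  qed
  have "(\<Sum>k\<in>?K. s k) = (\<Sum>k\<in>fst ` ?A. s k) + (\<Sum>k\<in>snd ` ?B. s k)"
    unfolding K by (rule sum.union_disjoint) (use fin disj in auto)
  also have "(\<Sum>k\<in>fst ` ?A. s k) = (\<Sum>c\<in>?A. 1)"
    by (subst sum.reindex) (use injf sA in \<open>auto intro: inj_on_subset\<close>)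
  also have "(\<Sum>k\<in>snd ` ?B. s k) = (\<Sum>c\<in>?B. - 1)"
    by (subst sum.reindex) (use injs sB in \<open>auto intro: inj_on_subset\<close>)
  finally have sumK: "(\<Sum>k\<in>?K. s k) = int (card ?A) - int (card ?B)" by simp
  have "?A = ?B \<union> ?C" "?B \<inter> ?C = {}" using lt by force+
  then have card: "card ?A = card ?B + card ?C"
    using card_Un_disjoint[of ?B ?C] fin by simp
  have "(\<Sum>k\<in>{1..i}. if k \<in> fst ` S \<union> snd ` S then - s k else s k)
      = (\<Sum>k\<in>{1..i}. s k - (if k \<in> fst ` S \<union> snd ` S then 2 * s k else 0))"
    by (rule sum.cong) auto
  also have "\<dots> = (\<Sum>k\<in>{1..i}. s k) - (\<Sum>k\<in>?K. 2 * s k)"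
    by (simp only: sum_subtractf sum.inter_restrict[OF finite_atLeastAtMost_int])
  also have "(\<Sum>k\<in>?K. 2 * s k) = 2 * (\<Sum>k\<in>?K. s k)"
    by (simp only: sum_distrib_left)
  finally show ?thesis
    unfolding push_down_def s_def[symmetric] using tel sumK card by simp
qed

lemma push_down_le: "S \<subseteq> chords n h \<Longrightarrow> 0 \<le> i \<Longrightarrow> push_down h S i \<le> h i"
  by (simp add: push_down_eq)

lemma push_down_less:
  assumes S: "S \<subseteq> chords n h" and c: "c \<in> S"
  shows "push_down h S (fst c) < h (fst c)"
proof -
  have "finite S" using S finite_chords finite_subset by blast
  moreover have "1 \<le> fst c" "fst c < snd c" using S c by (auto simp: chords_def)
  moreover have "c \<in> {d \<in> S. fst d \<le> fst c \<and> fst c < snd d}"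
    using c \<open>fst c < snd c\<close> by simp
  ultimately have "card {d \<in> S. fst d \<le> fst c \<and> fst c < snd d} > 0"
    by (metis (no_types, lifting) card_gt_0_iff empty_iff finite_Collect_conjI finite_Collect_conjI
        finite_subset mem_Collect_eq subsetI)
  then show ?thesis using push_down_eq[OF S, of "fst c"] \<open>1 \<le> fst c\<close> by simp
qed

text \<open>
  Formal integer combinations of tilings are elements of the free abelian group
  \<open>tile set \<Rightarrow>\<^sub>0 int\<close>, in which \<open>frag_of \<T>\<close> is the basis element \<open>\<T>\<close>, and
  \<open>frag_extend\<close> is extension by linearity.  The argument \<open>u\<close> need not be a Dyck
  path: \<open>push_down u S\<close> may go below \<open>0\<close>, and then the value is \<open>0\<close>.
\<close>

function tiling_sum :: "nat \<Rightarrow> (int \<Rightarrow> int) \<Rightarrow> (int \<Rightarrow> int) \<Rightarrow> (tile set \<Rightarrow>\<^sub>0 int)" where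
  "tiling_sum n l u =
     (if path_eq n l u then frag_of {}
      else if \<not> path_le n l u then 0
      else \<Sum>S\<in>{S. S \<subseteq> chords n u \<and> S \<noteq> {}}.
             frag_cmul ((- 1) ^ (1 + card S))
               (frag_extend (\<lambda>\<T>. frag_of (\<T> \<union> chord_tile u S ` S))
                 (tiling_sum n l (push_down u S))))"
  by auto
termination
proof (relation "measure (\<lambda>(n, l, u).
    if path_le n l u then Suc (\<Sum>i\<in>{0..2 * int n}. nat (u i - l i)) else 0)")
  fix n l u S
  assume le: "\<not> \<not> path_le n l u" and S0: "S \<in> {S. S \<subseteq> chords n u \<and> S \<noteq> {}}"
  then have S: "S \<subseteq> chords n u" by simp
  obtain c where c: "c \<in> S" using S0 by auto
  have c': "fst c \<in> {0..2 * int n}" using S c by (auto simp: chords_def)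
  have "(\<Sum>i\<in>{0..2 * int n}. nat (push_down u S i - l i))
      < (\<Sum>i\<in>{0..2 * int n}. nat (u i - l i))" if pl: "path_le n l (push_down u S)"
  proof (rule sum_strict_mono_ex1)
    show "\<forall>i\<in>{0..2 * int n}. nat (push_down u S i - l i) \<le> nat (u i - l i)"
      using push_down_le[OF S] by (intro ballI nat_mono diff_right_mono) simp
    show "\<exists>i\<in>{0..2 * int n}. nat (push_down u S i - l i) < nat (u i - l i)"
    proof (rule bexI[OF _ c'])
      show "nat (push_down u S (fst c) - l (fst c)) < nat (u (fst c) - l (fst c))"
        using push_down_less[OF S c] bspec[OF pl[unfolded path_le_def] c'] by linarith
    qed
  qed simp
  then show "((n, l, push_down u S), n, l, u) \<in> measure (\<lambda>(n, l, u).
    if path_le n l u then Suc (\<Sum>i\<in>{0..2 * int n}. nat (u i - l i)) else 0)"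
    using le by auto
qed simp

declare tiling_sum.simps [simp del]

text \<open>There are only finitely many tilings, so that the sum over all of them is meaningful:\<close>

lemma finite_dyck_tilings: "finite {\<T>. dyck_tiling n l u \<T>}"
proof -
  have "skew_boxes n l u \<subseteq> (SIGMA i:{0..2 * int n}. {l i..u i})"
    by (auto simp: skew_boxes_def)
  then have "finite (skew_boxes n l u)"
    by (rule finite_subset) auto
  moreover have "{\<T>. dyck_tiling n l u \<T>} \<subseteq> Pow (Pow (skew_boxes n l u))"
    by (auto simp: dyck_tiling_def partition_on_def)
  ultimately show ?thesis
    by (meson finite_Pow_iff finite_subset)
qed

end

theory Submission
  imports Defs
begin

text \<open>
  Fix a tiling \<open>\<T>\<close> of the region between \<open>l\<close> and \<open>u\<close>, and compare coefficients.  By induction,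
  the recursion gives \<open>\<T>\<close> the coefficient \<open>(-1) ^ (1 + card S)\<close> summed over the nonempty chord
  sets \<open>S\<close> such that \<open>\<T>\<close> arises by placing the tiles of \<open>S\<close> on top of a cover-inclusive tiling
  of the region below \<open>push_down u S\<close>.  Call such an \<open>S\<close>, empty or not, admissible.  The empty set
  is admissible exactly when \<open>\<T>\<close> itself is cover-inclusive, so it remains to see that the signs of
  all admissible sets cancel, unless the region is empty (\<open>signed_sum_admissible\<close>).  The
  cancellation is a sign-reversing involution: if there is an admissible set at all, then there is
  one chord \<open>c\<close>, depending on \<open>\<T>\<close> only, such that inserting \<open>c\<close> into an admissible set or
  removing it preserves admissibility (\<open>toggle_chord\<close>).

  To find \<open>c\<close>, observe first that in each column the chords of \<open>S\<close> that span it are nested, and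
  that the outermost one has its tile on top, the next one the second tile from the top, and so on.
  So \<open>\<T>\<close> determines the spanning chords of \<open>S\<close> one after the other, and \<open>S\<close> only decides when to
  stop.  As a consequence the admissible sets are closed under intersection, and there is a least one,
  \<open>V\<close>; any larger set all of whose tiles belong to \<open>\<T>\<close> is admissible again.

  Let \<open>c'\<close> be an innermost chord of \<open>V\<close>.  Since \<open>V\<close> is least, \<open>c'\<close> cannot be removed, so its tile
  covers a remaining tile that does not extend below all of it.  Among the remaining tiles that lie
  below some but not all of the extent of \<open>c'\<close>, one with the highest base turns out to lie along the
  boundary \<open>push_down u V\<close>, to stay inside \<open>c'\<close>, and to be the tile of a chord \<open>c\<close>
  (\<open>boundary_tile\<close>).  Over the extent of \<open>c'\<close>, all of \<open>u\<close> is pushed down by the same amount;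
  therefore \<open>c\<close> is a chord of \<open>u\<close>, and \<open>insert c V\<close> has all its tiles in \<open>\<T>\<close>.  If \<open>V\<close> is empty, the
  whole interval from \<open>0\<close> to \<open>2 * n\<close> plays the role of \<open>c'\<close>.
\<close>

section \<open>Chords of a Dyck path\<close>

lemma dyck_path_step:
  assumes "dyck_path n h" "0 \<le> i" "i < 2 * int n"
  shows "h (i + 1) = h i + 1 \<or> h (i + 1) = h i - 1"
proof -
  have "\<bar>h (i + 1) - h i\<bar> = 1" using assms by (auto simp: dyck_path_def)
  then show ?thesis by linarith
qed

lemma dyck_path_parity:
  assumes h: "dyck_path n h" and "0 \<le> i" "i \<le> 2 * int n"
  shows "even (h i + i)"
  using assms(2,3)
proof (induction i rule: int_ge_induct)
  case base
  then show ?case using h by (simp add: dyck_path_def)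
next
  case (step i)
  then show ?case using dyck_path_step[OF h, of i] by auto
qed

lemma chord_bounds:
  assumes "c \<in> chords n h"
  shows "1 \<le> fst c" "fst c < snd c" "snd c \<le> 2 * int n"
  using assms by (auto simp: chords_def)

lemma chord_above:
  assumes h: "dyck_path n h" and c: "c \<in> chords n h" and "fst c \<le> i" "i < snd c"
  shows "h (fst c - 1) < h i"
  using assms(3,4)
proof (induction i rule: int_ge_induct)
  case base
  then show ?case using c by (auto simp: chords_def)
next
  case (step i)
  have "h (i + 1) \<noteq> h (fst c - 1)" using c step by (auto simp: chords_def)
  moreover have "h (i + 1) = h i + 1 \<or> h (i + 1) = h i - 1"
    using dyck_path_step[OF h, of i] chord_bounds[OF c] step by linarith
  ultimately show ?case using step by linarith
qed

text \<open>
  Were \<open>d\<close> to end no earlier than \<open>c\<close>, the path would still be at or above the starting height of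
  \<open>d\<close> where \<open>c\<close> ends.  But there it is back at the starting height of \<open>c\<close>, which is smaller, since
  \<open>d\<close> starts inside \<open>c\<close>.
\<close>

lemma chords_nested:
  assumes h: "dyck_path n h" and c: "c \<in> chords n h" and d: "d \<in> chords n h"
    and "fst c < fst d" "fst d \<le> snd c"
  shows "snd d < snd c"
proof (rule ccontr)
  assume "\<not> snd d < snd c"
  then have "snd c \<le> snd d" by simp
  have c': "h (snd c) = h (fst c - 1)" and d': "h (snd d) = h (fst d - 1)"
    using c d by (auto simp: chords_def)
  have "h (fst c - 1) < h (fst d - 1)"
    using chord_above[OF h c, of "fst d - 1"] assms by simp
  moreover have "h (fst d - 1) \<le> h (snd c)"
    using chord_above[OF h d, of "snd c"] assms \<open>snd c \<le> snd d\<close> d'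
    by (cases "snd c = snd d") auto
  ultimately show False using c' by simp
qed

section \<open>The tiles that a set of chords pushes down\<close>

definition enclosing :: "(int \<times> int) set \<Rightarrow> int \<times> int \<Rightarrow> (int \<times> int) set" where
  "enclosing S c = {d \<in> S. fst d < fst c \<and> snd c < snd d}"

definition spanning :: "(int \<times> int) set \<Rightarrow> int \<Rightarrow> (int \<times> int) set" where
  "spanning S i = {d \<in> S. fst d \<le> i \<and> i < snd d}"

lemma mem_chord_tile:
  "(i, j) \<in> chord_tile h S c \<longleftrightarrow>
     fst c \<le> i \<and> i < snd c \<and> j = h i - 1 - 2 * int (card (enclosing S c))"
proof -
  have "{(a', b') \<in> S. a' < fst c \<and> snd c < b'} = enclosing S c"
    by (auto simp: enclosing_def)
  then show ?thesis by (cases c) (auto simp: chord_tile_def)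
qed

lemma extent_chord_tile: "horizontal_extent (chord_tile h S c) = {fst c..snd c - 1}"
  by (cases c) (auto simp: horizontal_extent_def chord_tile_def image_image)

lemma chord_tile_inject:
  assumes "chord_tile h S c = chord_tile h S' d" "fst c < snd c"
  shows "c = d"
proof -
  have "{fst c..snd c - 1} = {fst d..snd d - 1}"
    using assms(1) by (metis extent_chord_tile)
  then show ?thesis using assms(2) by (simp add: Icc_eq_Icc prod_eq_iff)
qed

lemma chord_tile_cong: "enclosing S c = enclosing S' c \<Longrightarrow> chord_tile h S c = chord_tile h S' c"
  by (auto simp: mem_chord_tile)

text \<open>
  Used for the chords that span a given column: they form a chain under nesting, ordered by their left
  ends, so that their nesting depths are the numbers from \<open>0\<close> on without gaps.
\<close>

lemma rank_bij:
  fixes f :: "'a \<Rightarrow> int"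
  assumes fin: "finite X" and inj: "inj_on f X"
  shows "bij_betw (\<lambda>x. card {y \<in> X. f y < f x}) X {..<card X}"
proof -
  let ?r = "\<lambda>x. card {y \<in> X. f y < f x}"
  have less: "?r x < ?r y" if "x \<in> X" "f x < f y" for x y
    by (rule psubset_card_mono) (use fin that in auto)
  have inj_r: "inj_on ?r X"
  proof (rule inj_onI)
    fix x y assume "x \<in> X" "y \<in> X" "?r x = ?r y"
    then have "\<not> f x < f y" "\<not> f y < f x" using less[of x y] less[of y x] by auto
    then show "x = y" using inj_onD[OF inj] \<open>x \<in> X\<close> \<open>y \<in> X\<close> by force
  qed
  have "?r ` X \<subseteq> {..<card X}"
  proof (rule image_subsetI)
    fix x assume "x \<in> X"
    then have "{y \<in> X. f y < f x} \<subset> X" by auto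
    then show "?r x \<in> {..<card X}" using psubset_card_mono[OF fin] by simp
  qed
  then have "?r ` X = {..<card X}"
    using inj_r by (intro card_subset_eq) (simp_all add: card_image)
  then show ?thesis using inj_r by (simp add: bij_betw_def)
qed

lemma enclosing_eq:
  assumes h: "dyck_path n h" and S: "S \<subseteq> chords n h" and c: "c \<in> spanning S i"
  shows "enclosing S c = {d \<in> spanning S i. fst d < fst c}"
proof -
  have "snd c < snd d" if "d \<in> spanning S i" "fst d < fst c" for d
    by (rule chords_nested[OF h]) (use S c that in \<open>auto simp: spanning_def\<close>)
  then show ?thesis using c by (auto simp: enclosing_def spanning_def)
qed

lemma finite_spanning: "S \<subseteq> chords n h \<Longrightarrow> finite (spanning S i)"
  by (rule finite_subset[OF _ finite_chords[of n h]]) (auto simp: spanning_def)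

lemma finite_enclosing: "S \<subseteq> chords n h \<Longrightarrow> finite (enclosing S c)"
  by (rule finite_subset[OF _ finite_chords[of n h]]) (auto simp: enclosing_def)

lemma depth_bij:
  assumes h: "dyck_path n h" and S: "S \<subseteq> chords n h"
  shows "bij_betw (\<lambda>c. card (enclosing S c)) (spanning S i) {..<card (spanning S i)}"
proof -
  have "spanning S i \<subseteq> chords n h" using S by (auto simp: spanning_def)
  then have "inj_on fst (spanning S i)" using inj_on_fst_chords inj_on_subset by blast
  then have "bij_betw (\<lambda>c. card {d \<in> spanning S i. fst d < fst c}) (spanning S i)
      {..<card (spanning S i)}"
    by (rule rank_bij[OF finite_spanning[OF S]])
  then show ?thesis
    by (rule bij_betw_cong[THEN iffD1, rotated]) (simp add: enclosing_eq[OF h S])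
qed

lemma depth_ex:
  assumes "dyck_path n h" "S \<subseteq> chords n h" "k < card (spanning S i)"
  obtains c where "c \<in> spanning S i" "card (enclosing S c) = k"
proof -
  have "k \<in> (\<lambda>c. card (enclosing S c)) ` spanning S i"
    using bij_betw_imp_surj_on[OF depth_bij[OF assms(1,2), of i]] assms(3) by simp
  then show thesis using that by blast
qed

lemma depth_less:
  assumes "dyck_path n h" "S \<subseteq> chords n h" "c \<in> spanning S i"
  shows "card (enclosing S c) < card (spanning S i)"
  using bij_betwE[OF depth_bij[OF assms(1,2), of i]] assms(3) by simp

lemma depth_strict:
  assumes S: "S \<subseteq> chords n h" and "c \<in> enclosing S d"
  shows "card (enclosing S c) < card (enclosing S d)"
  by (rule psubset_card_mono[OF finite_enclosing[OF S]]) (use assms in \<open>auto simp: enclosing_def\<close>)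

lemma chord_tiles_disjoint:
  assumes h: "dyck_path n h" and S: "S \<subseteq> chords n h"
    and cd: "c \<in> S" "d \<in> S" "c \<noteq> d"
  shows "chord_tile h S c \<inter> chord_tile h S d = {}"
proof (rule ccontr)
  assume "chord_tile h S c \<inter> chord_tile h S d \<noteq> {}"
  then obtain i j where "(i, j) \<in> chord_tile h S c" "(i, j) \<in> chord_tile h S d" by auto
  then have "c \<in> spanning S i" "d \<in> spanning S i" "card (enclosing S c) = card (enclosing S d)"
    using cd by (auto simp: mem_chord_tile spanning_def)
  then show False
    using inj_onD[OF bij_betw_imp_inj_on[OF depth_bij[OF h S, of i]]] cd by blast
qed

lemma push_down_spanning:
  assumes "S \<subseteq> chords n h" "0 \<le> i"
  shows "push_down h S i = h i - 2 * int (card (spanning S i))"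
  using push_down_eq[OF assms] by (simp add: spanning_def)

text \<open>
  In a column that is spanned by \<open>r\<close> chords of \<open>S\<close>, the path goes down by \<open>2 * r\<close>, which makes room
  for \<open>r\<close> boxes; by \<open>depth_bij\<close> each of the \<open>r\<close> chords fills exactly one of them.
\<close>

lemma Union_chord_tiles:
  assumes h: "dyck_path n h" and S: "S \<subseteq> chords n h"
  shows "\<Union> (chord_tile h S ` S) = skew_boxes n (push_down h S) h"
proof (rule set_eqI)
  fix x :: box
  obtain i j where x: "x = (i, j)" by (cases x)
  show "x \<in> \<Union> (chord_tile h S ` S) \<longleftrightarrow> x \<in> skew_boxes n (push_down h S) h"
  proof
    assume "x \<in> \<Union> (chord_tile h S ` S)"
    then obtain c where c: "c \<in> S" "(i, j) \<in> chord_tile h S c" using x by auto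
    then have col: "c \<in> spanning S i" and j: "j = h i - 1 - 2 * int (card (enclosing S c))"
      by (auto simp: mem_chord_tile spanning_def)
    have i: "0 \<le> i" "i \<le> 2 * int n"
      using chord_bounds[of c n h] c S by (auto simp: mem_chord_tile)
    have "odd (i + j)" using dyck_path_parity[OF h i] j by presburger
    moreover have "card (enclosing S c) < card (spanning S i)"
      by (rule depth_less[OF h S col])
    ultimately show "x \<in> skew_boxes n (push_down h S) h"
      using i j by (simp add: x skew_boxes_def push_down_spanning[OF S])
  next
    assume "x \<in> skew_boxes n (push_down h S) h"
    then have i: "0 \<le> i" "i \<le> 2 * int n" and odd: "odd (i + j)" and "j < h i"
      and low: "h i - 2 * int (card (spanning S i)) < j"
      by (auto simp: x skew_boxes_def push_down_spanning[OF S])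
    \<comment> \<open>The number of boxes above \<open>(i, j)\<close>, which is the depth of the chord that fills it.\<close>
    define k where "k = nat ((h i - 1 - j) div 2)"
    have "even (h i - 1 - j)" using dyck_path_parity[OF h i] odd by presburger
    then have j: "j = h i - 1 - 2 * int k" using \<open>j < h i\<close> by (auto simp: k_def)
    then have "k < card (spanning S i)" using low by simp
    then obtain c where "c \<in> spanning S i" "card (enclosing S c) = k"
      by (rule depth_ex[OF h S])
    then show "x \<in> \<Union> (chord_tile h S ` S)"
      using j by (auto simp: x spanning_def mem_chord_tile)
  qed
qed

lemma chord_tile_nonempty: "fst c < snd c \<Longrightarrow> chord_tile h S c \<noteq> {}"
  using mem_chord_tile[of "fst c" _ h S c] by blast

lemma partition_on_chord_tiles:
  assumes h: "dyck_path n h" and S: "S \<subseteq> chords n h"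
  shows "partition_on (skew_boxes n (push_down h S) h) (chord_tile h S ` S)"
proof (rule partition_onI)
  show "\<Union> (chord_tile h S ` S) = skew_boxes n (push_down h S) h"
    by (rule Union_chord_tiles[OF h S])
next
  show "disjnt p q" if "p \<in> chord_tile h S ` S" "q \<in> chord_tile h S ` S" "p \<noteq> q" for p q
    using that chord_tiles_disjoint[OF h S] unfolding disjnt_def by blast
next
  show "{} \<notin> chord_tile h S ` S"
    using chord_tile_nonempty chord_bounds(2) S by blast
qed

lemma dyck_tile_chord_tile:
  assumes h: "dyck_path n h" and c: "c \<in> chords n h"
  shows "dyck_tile (chord_tile h S c)"
proof -
  obtain a b where ab: "c = (a, b)" by (cases c)
  note B = chord_bounds[OF c]
  define m where "m = nat ((b - 1 - a) div 2)"
  have hab: "h (b - 1) = h a" using c ab by (auto simp: chords_def)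
  then have "even (b - 1 - a)"
    using dyck_path_parity[OF h, of a] dyck_path_parity[OF h, of "b - 1"] B ab
    by simp
  then have m: "2 * int m = b - 1 - a" using B ab by (auto simp: m_def)
  have ha: "h a = h (a - 1) + 1" using c ab by (auto simp: chords_def)
  have "dyck_path m (\<lambda>k. h (a + k) - h a)"
    unfolding dyck_path_def
  proof (intro conjI ballI)
    show "h (a + 2 * int m) - h a = 0" using hab by (simp only: m) simp
    show "0 \<le> h (a + i) - h a" if "i \<in> {0..2 * int m}" for i
      using chord_above[OF h c, of "a + i"] that m ha ab by simp
    show "\<bar>h (a + (i + 1)) - h a - (h (a + i) - h a)\<bar> = 1" if "i \<in> {0..<2 * int m}" for i
      using dyck_path_step[OF h, of "a + i"] that m B ab by (auto simp: add.assoc)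
  qed simp
  moreover have "chord_tile h S c
      = (\<lambda>k. (a + k, (h a - 1 - 2 * int (card (enclosing S c))) + (h (a + k) - h a))) ` {0..2 * int m}"
    (is "_ = ?R")
  proof (rule set_eqI)
    fix x :: box
    obtain i j where x: "x = (i, j)" by (cases x)
    have "x \<in> ?R" if "x \<in> chord_tile h S c"
      by (rule image_eqI[of _ _ "i - a"]) (use that m ab x in \<open>auto simp: mem_chord_tile\<close>)
    moreover have "x \<in> chord_tile h S c" if "x \<in> ?R"
      using that m ab x by (auto simp: mem_chord_tile)
    ultimately show "x \<in> chord_tile h S c \<longleftrightarrow> x \<in> ?R" by blast
  qed
  ultimately show ?thesis unfolding dyck_tile_def by blast
qed

lemma dyck_path_push_down:
  assumes h: "dyck_path n h" and S: "S \<subseteq> chords n h"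
    and l: "dyck_path n l" "path_le n l (push_down h S)"
  shows "dyck_path n (push_down h S)"
  unfolding dyck_path_def
proof (intro conjI ballI)
  show "push_down h S 0 = 0" using h by (simp add: push_down_def dyck_path_def)
  have "spanning S (2 * int n) = {}" using chord_bounds(3) S by (fastforce simp: spanning_def)
  then show "push_down h S (2 * int n) = 0"
    using h by (simp add: push_down_spanning[OF S] dyck_path_def)
  show "0 \<le> push_down h S i" if "i \<in> {0..2 * int n}" for i
    using l that by (force simp: dyck_path_def path_le_def)
  show "\<bar>push_down h S (i + 1) - push_down h S i\<bar> = 1" if "i \<in> {0..<2 * int n}" for i
  proof -
    have "{1..i + 1} = insert (i + 1) {1..i}" using that by auto
    then show ?thesis using dyck_path_step[OF h, of i] that by (auto simp: push_down_def)
  qed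
qed

section \<open>Dyck tiles as graphs\<close>

text \<open>
  A Dyck tile as the graph of a height function over its extent, in absolute coordinates.
\<close>

definition tile_graph :: "tile \<Rightarrow> int \<Rightarrow> int \<Rightarrow> (int \<Rightarrow> int) \<Rightarrow> bool" where
  "tile_graph T p q g \<longleftrightarrow> p \<le> q \<and> T = (\<lambda>i. (i, g i)) ` {p..q} \<and> g q = g p
     \<and> (\<forall>i\<in>{p..q}. g p \<le> g i) \<and> (\<forall>i\<in>{p..<q}. \<bar>g (i + 1) - g i\<bar> = 1)"

lemma dyck_tile_graph:
  assumes "dyck_tile T"
  obtains p q g where "tile_graph T p q g"
proof -
  obtain a b m d where d: "dyck_path m d" and T: "T = (\<lambda>k. (a + k, b + d k)) ` {0..2 * int m}"
    using assms by (auto simp: dyck_tile_def)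
  have "T = (\<lambda>i. (i, b + d (i - a))) ` {a..a + 2 * int m}"
    unfolding T by (force simp: image_iff intro: rev_image_eqI[of "_ - a"])
  moreover have "\<bar>d (i + 1 - a) - d (i - a)\<bar> = 1" if "i \<in> {a..<a + 2 * int m}" for i
  proof -
    have "i + 1 - a = (i - a) + 1" by simp
    moreover have "i - a \<in> {0..<2 * int m}" using that by auto
    ultimately show ?thesis using d unfolding dyck_path_def by metis
  qed
  ultimately have "tile_graph T a (a + 2 * int m) (\<lambda>i. b + d (i - a))"
    using d by (auto simp: tile_graph_def dyck_path_def)
  then show thesis by (rule that)
qed

lemma tile_graph_step: "tile_graph T p q g \<Longrightarrow> p \<le> i \<Longrightarrow> i < q \<Longrightarrow> \<bar>g (i + 1) - g i\<bar> = 1"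
  by (auto simp: tile_graph_def)

lemma mem_tile_graph: "tile_graph T p q g \<Longrightarrow> (i, j) \<in> T \<longleftrightarrow> p \<le> i \<and> i \<le> q \<and> j = g i"
  by (auto simp: tile_graph_def)

lemma extent_tile_graph: "tile_graph T p q g \<Longrightarrow> horizontal_extent T = {p..q}"
  by (auto simp: tile_graph_def horizontal_extent_def image_image)

text \<open>
  The height of the first and the last box of a Dyck tile.  The choice of a tile with maximal base
  drives the search in \<open>boundary_tile\<close>.
\<close>

definition base :: "tile \<Rightarrow> int" where
  "base T = Min (snd ` T)"

lemma base_tile_graph:
  assumes "tile_graph T p q g"
  shows "base T = g p"
  unfolding base_def using assms
  by (intro Min_eqI) (auto simp: tile_graph_def image_image)

text \<open>
  A discrete intermediate value theorem: a function with even values and steps of size at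
  most \<open>2\<close> cannot change its sign without being \<open>0\<close> in between.
\<close>

lemma positive_along_interval:
  fixes f :: "int \<Rightarrow> int"
  assumes ne: "\<And>k. a \<le> k \<Longrightarrow> k \<le> b \<Longrightarrow> f k \<noteq> 0 \<and> even (f k)"
    and step: "\<And>k. a \<le> k \<Longrightarrow> k < b \<Longrightarrow> \<bar>f (k + 1) - f k\<bar> \<le> 2"
    and i: "a \<le> i" "i \<le> b" "0 < f i" and k: "a \<le> k" "k \<le> b"
  shows "0 < f k"
proof (cases "i \<le> k")
  case True
  then show ?thesis using k(2)
  proof (induction k rule: int_ge_induct)
    case base
    then show ?case using i by simp
  next
    case (step k)
    then have "0 < f k" by simp
    moreover have "f k \<noteq> 1" using ne[of k] i step by auto
    ultimately show ?case using ne[of "k + 1"] assms(2)[of k] step i by linarith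
  qed
next
  case False
  then have "k \<le> i" by simp
  then show ?thesis using k(1)
  proof (induction k rule: int_le_induct)
    case base
    then show ?case using i by simp
  next
    case (step k)
    then have "0 < f k" by simp
    moreover have "f k \<noteq> 1" using ne[of k] i step by auto
    ultimately show ?case using ne[of "k - 1"] assms(2)[of "k - 1"] step i by auto
  qed
qed

section \<open>Tiles along the upper boundary\<close>

locale skew_tiling =
  fixes n :: nat and l u :: "int \<Rightarrow> int" and \<T> :: "tile set"
  assumes l: "dyck_path n l" and u: "dyck_path n u" and tiling: "dyck_tiling n l u \<T>"
begin

lemma box_bounds:
  assumes "X \<in> \<T>" "(i, j) \<in> X"
  shows "0 \<le> i" "i \<le> 2 * int n" "odd (i + j)" "l i < j" "j < u i"
proof -
  have "(i, j) \<in> skew_boxes n l u"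
    using assms tiling by (auto simp: dyck_tiling_def partition_on_def)
  then show "0 \<le> i" "i \<le> 2 * int n" "odd (i + j)" "l i < j" "j < u i"
    by (auto simp: skew_boxes_def)
qed

lemma tile_at:
  assumes "0 \<le> i" "i \<le> 2 * int n" "odd (i + j)" "l i < j" "j < u i"
  obtains X where "X \<in> \<T>" "(i, j) \<in> X"
proof -
  have "(i, j) \<in> \<Union> \<T>"
    using assms tiling by (auto simp: dyck_tiling_def partition_on_def skew_boxes_def)
  then show thesis using that by blast
qed

lemma tile_unique:
  assumes "X \<in> \<T>" "Y \<in> \<T>" "x \<in> X" "x \<in> Y"
  shows "X = Y"
  using assms tiling unfolding dyck_tiling_def partition_on_def disjoint_def by blast

lemma graph_ex:
  assumes "X \<in> \<T>"
  obtains p q g where "tile_graph X p q g"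
  using assms tiling dyck_tile_graph unfolding dyck_tiling_def by blast

lemma finite_tiling: "finite \<T>"
proof -
  have "skew_boxes n l u \<subseteq> (SIGMA i:{0..2 * int n}. {l i..u i})"
    by (auto simp: skew_boxes_def)
  then have "finite (skew_boxes n l u)"
    by (rule finite_subset) auto
  then show ?thesis using tiling finite_elements unfolding dyck_tiling_def by blast
qed

text \<open>
  The height difference of two disjoint tiles is even and never \<open>0\<close> on the common columns.
\<close>

lemma no_crossing:
  assumes X: "X \<in> \<T>" "tile_graph X p q g" and Y: "Y \<in> \<T>" "tile_graph Y p' q' g'" and "X \<noteq> Y"
    and i: "p \<le> i" "i \<le> q" "p' \<le> i" "i \<le> q'" "g' i < g i"
    and k: "p \<le> k" "k \<le> q" "p' \<le> k" "k \<le> q'"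
  shows "g' k < g k"
proof -
  have ne: "g m - g' m \<noteq> 0 \<and> even (g m - g' m)" if "max p p' \<le> m" "m \<le> min q q'" for m
  proof -
    have m: "(m, g m) \<in> X" "(m, g' m) \<in> Y"
      using that mem_tile_graph[OF X(2)] mem_tile_graph[OF Y(2)] by auto
    then have "g m \<noteq> g' m" using tile_unique[OF X(1) Y(1)] \<open>X \<noteq> Y\<close> by metis
    moreover have "odd (m + g m)" "odd (m + g' m)"
      using box_bounds(3)[OF X(1) m(1)] box_bounds(3)[OF Y(1) m(2)] by auto
    ultimately show ?thesis by auto
  qed
  have step: "\<bar>(g (m + 1) - g' (m + 1)) - (g m - g' m)\<bar> \<le> 2"
    if "max p p' \<le> m" "m < min q q'" for m
  proof -
    have "\<bar>g (m + 1) - g m\<bar> = 1" "\<bar>g' (m + 1) - g' m\<bar> = 1"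
      using X(2) Y(2) that by (auto simp: tile_graph_def)
    then show ?thesis by linarith
  qed
  have "0 < g k - g' k"
    by (rule positive_along_interval[of "max p p'" "min q q'" "\<lambda>m. g m - g' m" i, OF ne step])
      (use i k in auto)
  then show ?thesis by simp
qed

text \<open>
  Cover-inclusion puts the left end of \<open>Y\<close> over \<open>X\<close>, and since tiles do not cross, \<open>Y\<close> is above
  \<open>X\<close> there.
\<close>

lemma cover_higher:
  assumes ci: "cover_inclusive \<T>" and X: "X \<in> \<T>" and Y: "Y \<in> \<T>" and cov: "covers Y X"
  shows "horizontal_extent Y \<subseteq> horizontal_extent X" "base X < base Y"
proof -
  show sub: "horizontal_extent Y \<subseteq> horizontal_extent X"
    using assms by (auto simp: cover_inclusive_def)
  obtain p q g where gX: "tile_graph X p q g" by (rule graph_ex[OF X])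
  obtain p' q' g' where gY: "tile_graph Y p' q' g'" by (rule graph_ex[OF Y])
  obtain i where i: "p \<le> i" "i \<le> q" "p' \<le> i" "i \<le> q'" "g i < g' i" and "Y \<noteq> X"
    using cov mem_tile_graph[OF gX] mem_tile_graph[OF gY] by (auto simp: covers_def)
  have p': "p \<le> p'" "p' \<le> q" "p' \<le> q'"
    using sub gY by (auto simp: extent_tile_graph[OF gX] extent_tile_graph[OF gY] tile_graph_def)
  have "g p' < g' p'"
    by (rule no_crossing[OF Y gY X gX \<open>Y \<noteq> X\<close>]) (use i p' in auto)
  moreover have "g p \<le> g p'" using gX p' by (auto simp: tile_graph_def)
  ultimately show "base X < base Y"
    by (simp add: base_tile_graph[OF gX] base_tile_graph[OF gY])
qed

text \<open>
  Call a tile partial if its extent meets \<open>{p..q}\<close> without containing it, and let \<open>Y\<close> be a partial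
  tile with maximal base.  If \<open>Y\<close> starts inside the interval, then no tile contains the box to the
  upper left of its first box: such a tile ends there, by cover-inclusion, and would be a partial tile
  with higher base.  So the boundary goes up at the first box, and since over \<open>{p..q}\<close> it is lowest at \<open>p\<close> and \<open>q\<close>,
  \<open>Y\<close> must end inside the interval as well, where the mirror image of the argument applies.  Now no
  tile covers \<open>Y\<close>, because it would be partial too.  So \<open>Y\<close> follows the boundary, and the boundary goes up to
  its first box and down from its last one, which is what makes the extent of \<open>Y\<close> a chord.
\<close>

lemma boundary_tile:
  assumes ci: "cover_inclusive \<T>" and pq: "0 \<le> p" "q \<le> 2 * int n"
    and val: "u p = u q" "\<And>i. p \<le> i \<Longrightarrow> i \<le> q \<Longrightarrow> u p \<le> u i"
    and X: "X \<in> \<T>" "horizontal_extent X \<inter> {p..q} \<noteq> {}" "\<not> {p..q} \<subseteq> horizontal_extent X"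
  obtains c where "c \<in> chords n u" "p < fst c" "snd c \<le> q"
    "(\<lambda>i. (i, u i - 1)) ` {fst c..snd c - 1} \<in> \<T>"
proof -
  define P where
    "P = {Y \<in> \<T>. horizontal_extent Y \<inter> {p..q} \<noteq> {} \<and> \<not> {p..q} \<subseteq> horizontal_extent Y}"
  have "finite P" "P \<noteq> {}" using finite_tiling X by (auto simp: P_def)
  then have "Max (base ` P) \<in> base ` P" by simp
  then obtain Y where YP: "Y \<in> P" and Max: "base Y = Max (base ` P)" by force
  have max: "base Z \<le> base Y" if "Z \<in> P" for Z
    using that \<open>finite P\<close> Max by simp
  have Y: "Y \<in> \<T>" using YP by (simp add: P_def)
  obtain a e g where gY: "tile_graph Y a e g" by (rule graph_ex[OF Y])
  define j where "j = g a"
  have ge: "a \<le> e" "g e = j" "\<And>i. a \<le> i \<Longrightarrow> i \<le> e \<Longrightarrow> j \<le> g i"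
    using gY by (auto simp: tile_graph_def j_def)
  note memY = mem_tile_graph[OF gY] and extY = extent_tile_graph[OF gY]
  have baseY: "base Y = j" using base_tile_graph[OF gY] by (simp add: j_def)
  have bounds: "0 \<le> i" "i \<le> 2 * int n" "odd (i + g i)" "l i < g i" "g i < u i"
    if "a \<le> i" "i \<le> e" for i
    using box_bounds[OF Y, of i "g i"] memY that by auto
  have par: "even (u i + i)" if "0 \<le> i" "i \<le> 2 * int n" for i
    using dyck_path_parity[OF u that] .
  have "a \<noteq> 0" using bounds(4,5)[of a] ge(1) l u by (auto simp: dyck_path_def)
  then have a: "0 < a" using bounds(1)[of a] ge(1) by simp
  have "e \<noteq> 2 * int n" using bounds(4,5)[of e] ge(1) l u by (auto simp: dyck_path_def)
  then have e: "e < 2 * int n" using bounds(2)[of e] ge(1) by simp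

  \<comment> \<open>The box to the upper left of the first box of \<open>Y\<close> is outside of the region if \<open>Y\<close>
    starts inside the interval.\<close>
  have left: "u (a - 1) = j" if "p < a" "a \<le> q"
  proof -
    have la: "l (a - 1) < j + 1"
      using dyck_path_step[OF l, of "a - 1"] bounds(4)[of a] ge(1) a e by (auto simp: j_def)
    have "\<not> j + 1 < u (a - 1)"
    proof
      assume "j + 1 < u (a - 1)"
      moreover have "odd ((a - 1) + (j + 1))" using bounds(3)[of a] ge(1) by (simp add: j_def)
      ultimately obtain Z where Z: "Z \<in> \<T>" "(a - 1, j + 1) \<in> Z"
        using tile_at[of "a - 1" "j + 1"] la a e ge(1) by auto
      obtain a' e' g' where gZ: "tile_graph Z a' e' g'" by (rule graph_ex[OF Z(1)])
      have z: "a' \<le> a - 1" "a - 1 \<le> e'" "g' (a - 1) = j + 1"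
        using Z(2) mem_tile_graph[OF gZ] by auto
      have "Z \<noteq> Y" using Z(2) memY by auto
      \<comment> \<open>If \<open>Z\<close> continued to column \<open>a\<close>, it would have to pass above \<open>Y\<close>.\<close>
      have "e' = a - 1"
      proof (rule ccontr)
        assume "e' \<noteq> a - 1"
        then have "a \<le> e'" using z by simp
        then have aZ: "(a, g' a) \<in> Z" using mem_tile_graph[OF gZ] z by auto
        have aY: "(a, j) \<in> Y" using memY ge(1) by (auto simp: j_def)
        have "g' a \<noteq> j" using aY aZ \<open>Z \<noteq> Y\<close> tile_unique[OF Z(1) Y] by metis
        moreover have "\<bar>g' (a - 1 + 1) - g' (a - 1)\<bar> = 1"
          by (rule tile_graph_step[OF gZ]) (use z \<open>a \<le> e'\<close> in auto)
        ultimately have "j < g' a" using z by auto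
        then have "covers Z Y" using aY aZ \<open>Z \<noteq> Y\<close> unfolding covers_def by blast
        then have "horizontal_extent Z \<subseteq> horizontal_extent Y"
          using cover_higher(1)[OF ci Y Z(1)] by simp
        then show False using z extY extent_tile_graph[OF gZ] by auto
      qed
      then have "Z \<in> P" using that z Z(1) extent_tile_graph[OF gZ] by (auto simp: P_def)
      moreover have "base Z = j + 1"
        using base_tile_graph[OF gZ] gZ z \<open>e' = a - 1\<close> by (auto simp: tile_graph_def)
      ultimately show False using max[of Z] baseY by simp
    qed
    moreover have "j < u a" using bounds(5)[of a] ge(1) by (simp add: j_def)
    moreover have "u a = u (a - 1) + 1 \<or> u a = u (a - 1) - 1"
      using dyck_path_step[OF u, of "a - 1"] a e ge(1) by auto
    moreover have "u (a - 1) \<noteq> j + 1"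
      using par[of "a - 1"] bounds(3)[of a] ge(1) a e by (auto simp: j_def)
    ultimately show ?thesis by linarith
  qed

  \<comment> \<open>The mirror image of the previous step.\<close>
  have right: "u (e + 1) = j" if "p \<le> e" "e < q"
  proof -
    have le: "l (e + 1) < j + 1"
      using dyck_path_step[OF l, of e] bounds(4)[of e] ge(1,2) a e by auto
    have "\<not> j + 1 < u (e + 1)"
    proof
      assume "j + 1 < u (e + 1)"
      moreover have "odd ((e + 1) + (j + 1))" using bounds(3)[of e] ge(1,2) by simp
      ultimately obtain Z where Z: "Z \<in> \<T>" "(e + 1, j + 1) \<in> Z"
        using tile_at[of "e + 1" "j + 1"] le a e ge(1) by auto
      obtain a' e' g' where gZ: "tile_graph Z a' e' g'" by (rule graph_ex[OF Z(1)])
      have z: "a' \<le> e + 1" "e + 1 \<le> e'" "g' (e + 1) = j + 1"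
        using Z(2) mem_tile_graph[OF gZ] by auto
      have "Z \<noteq> Y" using Z(2) memY by auto
      have "a' = e + 1"
      proof (rule ccontr)
        assume "a' \<noteq> e + 1"
        then have "a' \<le> e" using z by simp
        then have eZ: "(e, g' e) \<in> Z" using mem_tile_graph[OF gZ] z by auto
        have eY: "(e, j) \<in> Y" using memY ge(1,2) by auto
        have "g' e \<noteq> j" using eY eZ \<open>Z \<noteq> Y\<close> tile_unique[OF Z(1) Y] by metis
        moreover have "\<bar>g' (e + 1) - g' e\<bar> = 1"
          by (rule tile_graph_step[OF gZ]) (use z \<open>a' \<le> e\<close> in auto)
        ultimately have "j < g' e" using z by auto
        then have "covers Z Y" using eY eZ \<open>Z \<noteq> Y\<close> unfolding covers_def by blast
        then have "horizontal_extent Z \<subseteq> horizontal_extent Y"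
          using cover_higher(1)[OF ci Y Z(1)] by simp
        then show False using z extY extent_tile_graph[OF gZ] by auto
      qed
      then have "Z \<in> P" using that z Z(1) extent_tile_graph[OF gZ] by (auto simp: P_def)
      moreover have "base Z = j + 1"
        using base_tile_graph[OF gZ] z \<open>a' = e + 1\<close> by auto
      ultimately show False using max[of Z] baseY by simp
    qed
    moreover have "j < u e" using bounds(5)[of e] ge(1,2) by simp
    moreover have "u (e + 1) = u e + 1 \<or> u (e + 1) = u e - 1"
      using dyck_path_step[OF u, of e] a e ge(1) by auto
    moreover have "u (e + 1) \<noteq> j + 1"
      using par[of "e + 1"] bounds(3)[of e] ge(1,2) a e by auto
    ultimately show ?thesis by linarith
  qed

  obtain x where x: "p \<le> x" "x \<le> q" "a \<le> x" "x \<le> e" using YP extY by (auto simp: P_def)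
  have "\<not> (a \<le> p \<and> q \<le> e)" using YP extY by (auto simp: P_def)
  then consider "p < a" | "e < q" by linarith
  \<comment> \<open>If \<open>Y\<close> starts inside the interval, then it also ends inside: otherwise \<open>Y\<close> reaches column \<open>q\<close>,
    at which the boundary is too low for it.  The same holds with left and right exchanged.\<close>
  then have inside: "p < a \<and> e < q"
  proof cases
    case 1
    have "\<not> q \<le> e"
    proof
      assume "q \<le> e"
      then have "j < u q" using ge(3)[of q] bounds(5)[of q] x by simp
      then show False using left[OF 1] val(1) val(2)[of "a - 1"] 1 x by simp
    qed
    then show ?thesis using 1 by simp
  next
    case 2
    have "\<not> a \<le> p"
    proof
      assume "a \<le> p"
      then have "j < u p" using ge(3)[of p] bounds(5)[of p] x by simp
      then show False using right[OF _ 2] val(2)[of "e + 1"] 2 x by simp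
    qed
    then show ?thesis using 2 by simp
  qed
  then have ends: "u (a - 1) = j" "u (e + 1) = j" using left right x by auto

  \<comment> \<open>A tile that covers \<open>Y\<close> would have a higher base, and it is partial because it avoids \<open>p\<close>, as
    \<open>Y\<close> does.\<close>
  have top: "g i = u i - 1" if i: "a \<le> i" "i \<le> e" for i
  proof (rule ccontr)
    assume "g i \<noteq> u i - 1"
    moreover have "even (u i - 1 - g i)"
      using par[OF bounds(1,2)[OF i]] bounds(3)[OF i] by presburger
    ultimately have "g i + 2 < u i" using bounds(5)[OF i] by presburger
    then obtain Z where Z: "Z \<in> \<T>" "(i, g i + 2) \<in> Z"
      using tile_at[of i "g i + 2"] bounds[OF i] by auto
    have "Z \<noteq> Y" using Z(2) memY by auto
    then have "covers Z Y" using Z(2) memY i by (force simp: covers_def)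
    then have "horizontal_extent Z \<subseteq> {a..e}" "j < base Z"
      using cover_higher[OF ci Y Z(1)] extY baseY by auto
    moreover have "i \<in> horizontal_extent Z" using Z(2) by (force simp: horizontal_extent_def)
    moreover have "p \<in> {p..q}" "p \<notin> {a..e}" "i \<in> {p..q}" using inside i x by auto
    ultimately have "Z \<in> P" using Z(1) unfolding P_def by blast
    then show False using max[of Z] baseY \<open>j < base Z\<close> by simp
  qed
  have "(a, e + 1) \<in> chords n u"
    using top[of a] top[of e] ends ge a e top by (force simp: chords_def j_def)
  moreover have "(\<lambda>i. (i, u i - 1)) ` {a..e} = Y"
    using top gY by (auto simp: tile_graph_def)
  ultimately show thesis using that[of "(a, e + 1)"] inside Y by auto
qed

end

section \<open>Placing the tiles of a chord set on a tiling\<close>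

lemma partition_on_Diff_subset:
  assumes "partition_on A P" "Q \<subseteq> P"
  shows "partition_on (A - \<Union>Q) (P - Q)"
proof (rule partition_onI)
  have disj: "p \<inter> q = {}" if "p \<in> P" "q \<in> P" "p \<noteq> q" for p q
    using assms(1) that by (simp add: partition_on_def disjoint_def)
  have "\<Union> P = A" using assms(1) by (simp add: partition_on_def)
  then show "\<Union> (P - Q) = A - \<Union> Q"
    using disj assms(2) by fast
  show "disjnt p q" if "p \<in> P - Q" "q \<in> P - Q" "p \<noteq> q" for p q
    using disj that by (simp add: disjnt_def)
  show "{} \<notin> P - Q" using assms by (auto simp: partition_on_def)
qed

lemma skew_boxes_push_down:
  assumes h: "dyck_path n h" and S: "S \<subseteq> chords n h" and le: "path_le n l (push_down h S)"
  shows "skew_boxes n l h = skew_boxes n l (push_down h S) \<union> skew_boxes n (push_down h S) h"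
    and "skew_boxes n l (push_down h S) \<inter> skew_boxes n (push_down h S) h = {}"
proof -
  have "l i \<le> push_down h S i" "push_down h S i \<le> h i" "even (push_down h S i + i)"
    if "0 \<le> i" "i \<le> 2 * int n" for i
    using le that push_down_le[OF S] dyck_path_parity[OF h that] push_down_spanning[OF S]
    by (auto simp: path_le_def)
  note path = this
  show "skew_boxes n l h = skew_boxes n l (push_down h S) \<union> skew_boxes n (push_down h S) h"
  proof (rule set_eqI)
    fix x :: box
    obtain i j where x: "x = (i, j)" by (cases x)
    have "push_down h S i \<noteq> j" if "0 \<le> i" "i \<le> 2 * int n" "odd (i + j)"
      using path(3)[OF that(1,2)] that(3) by (auto simp: add.commute)
    then show "x \<in> skew_boxes n l h \<longleftrightarrow>
        x \<in> skew_boxes n l (push_down h S) \<union> skew_boxes n (push_down h S) h"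
      using path(1,2)[of i] by (auto simp: x skew_boxes_def)
  qed
  show "skew_boxes n l (push_down h S) \<inter> skew_boxes n (push_down h S) h = {}"
    by (auto simp: skew_boxes_def)
qed

lemma dyck_tiling_add_chord_tiles:
  assumes h: "dyck_path n h" and S: "S \<subseteq> chords n h" and le: "path_le n l (push_down h S)"
    and T: "dyck_tiling n l (push_down h S) \<T>"
  shows "dyck_tiling n l h (\<T> \<union> chord_tile h S ` S)" and "\<T> \<inter> chord_tile h S ` S = {}"
proof -
  note box = skew_boxes_push_down[OF h S le] and part = partition_on_chord_tiles[OF h S]
  have T': "partition_on (skew_boxes n l (push_down h S)) \<T>"
    using T by (simp add: dyck_tiling_def)
  then have "partition_on (skew_boxes n l h) (\<T> \<union> chord_tile h S ` S)"
    unfolding box(1) using part box(2)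
    unfolding partition_on_def by (simp add: disjoint_union)
  then show "dyck_tiling n l h (\<T> \<union> chord_tile h S ` S)"
    using T S dyck_tile_chord_tile[OF h] by (auto simp: dyck_tiling_def)
  show "\<T> \<inter> chord_tile h S ` S = {}"
  proof (rule ccontr)
    assume "\<T> \<inter> chord_tile h S ` S \<noteq> {}"
    then obtain X where X: "X \<in> \<T>" "X \<in> chord_tile h S ` S" by auto
    then have "X \<subseteq> skew_boxes n l (push_down h S)" "X \<subseteq> skew_boxes n (push_down h S) h"
      using partition_onD1[OF T'] partition_onD1[OF part] by auto
    moreover have "X \<noteq> {}" using X(1) partition_onD3[OF T'] by auto
    ultimately show False using box(2) by blast
  qed
qed

section \<open>Chord sets compatible with a tiling\<close>

context skew_tiling
begin

definition compatible :: "(int \<times> int) set \<Rightarrow> bool" where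
  "compatible S \<longleftrightarrow> S \<subseteq> chords n u \<and> chord_tile u S ` S \<subseteq> \<T>"

definition rest :: "(int \<times> int) set \<Rightarrow> tile set" where
  "rest S = \<T> - chord_tile u S ` S"

text \<open>
  The nonempty ones are the chord sets that contribute to the coefficient of \<open>\<T>\<close>: the recursion reaches \<open>\<T>\<close>
  by placing the tiles of \<open>S\<close> on top of \<open>rest S\<close>, and by induction \<open>rest S\<close> has coefficient \<open>1\<close>
  or \<open>0\<close> according to whether it is cover-inclusive.
\<close>

definition admissible :: "(int \<times> int) set \<Rightarrow> bool" where
  "admissible S \<longleftrightarrow> compatible S \<and> cover_inclusive (rest S)"

lemma compatibleD:
  assumes "compatible S"
  shows "S \<subseteq> chords n u" "c \<in> S \<Longrightarrow> chord_tile u S c \<in> \<T>"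
  using assms by (auto simp: compatible_def)

text \<open>
  The lowest box that \<open>S\<close> occupies in a column belongs to \<open>\<T>\<close>, hence it lies above \<open>l\<close>, and the
  pushed-down path runs directly below this box.
\<close>

lemma path_le_push_down:
  assumes S: "compatible S" and le: "path_le n l u"
  shows "path_le n l (push_down u S)"
  unfolding path_le_def
proof
  fix i assume "i \<in> {0..2 * int n}"
  then have i: "0 \<le> i" "i \<le> 2 * int n" by auto
  note S' = compatibleD(1)[OF S]
  show "l i \<le> push_down u S i"
  proof (cases "spanning S i = {}")
    case True
    then show ?thesis using le i push_down_spanning[OF S' i(1)] by (auto simp: path_le_def)
  next
    case False
    then have "card (spanning S i) - 1 < card (spanning S i)"
      using finite_spanning[OF S'] by (simp add: card_gt_0_iff)
    then obtain c where c: "c \<in> spanning S i" "card (enclosing S c) = card (spanning S i) - 1"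
      by (rule depth_ex[OF u S'])
    then have "(i, u i - 1 - 2 * int (card (spanning S i) - 1)) \<in> chord_tile u S c" "c \<in> S"
      by (auto simp: mem_chord_tile spanning_def)
    then have "l i < u i - 1 - 2 * int (card (spanning S i) - 1)"
      using box_bounds(4) compatibleD(2)[OF S] by blast
    then show ?thesis
      using \<open>card (spanning S i) - 1 < card (spanning S i)\<close> push_down_spanning[OF S' i(1)] by simp
  qed
qed

lemma dyck_tiling_rest:
  assumes S: "compatible S" and le: "path_le n l u"
  shows "dyck_tiling n l (push_down u S) (rest S)"
proof -
  note S' = compatibleD(1)[OF S]
  note box = skew_boxes_push_down[OF u S' path_le_push_down[OF S le]]
  have "partition_on (skew_boxes n l u - \<Union> (chord_tile u S ` S)) (rest S)"
    unfolding rest_def using tiling compatibleD(2)[OF S]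
    by (intro partition_on_Diff_subset) (auto simp: dyck_tiling_def)
  moreover have "skew_boxes n l u - \<Union> (chord_tile u S ` S) = skew_boxes n l (push_down u S)"
    unfolding Union_chord_tiles[OF u S'] using box by blast
  ultimately show ?thesis using tiling by (auto simp: dyck_tiling_def rest_def)
qed

text \<open>
  Both chords put a tile of \<open>\<T>\<close> on the same box, so the two tiles coincide, and a tile determines
  its chord.
\<close>

lemma compatible_same_depth:
  assumes "compatible S" "compatible S'" "c \<in> spanning S i" "d \<in> spanning S' i"
    and "card (enclosing S c) = card (enclosing S' d)"
  shows "c = d"
proof -
  have c: "c \<in> S" and d: "d \<in> S'" using assms by (auto simp: spanning_def)
  have "(i, u i - 1 - 2 * int (card (enclosing S c))) \<in> chord_tile u S c \<inter> chord_tile u S' d"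
    using assms by (auto simp: spanning_def mem_chord_tile)
  then have "chord_tile u S c = chord_tile u S' d"
    using tile_unique compatibleD(2)[OF assms(1) c] compatibleD(2)[OF assms(2) d] by blast
  then show "c = d"
    by (rule chord_tile_inject) (use chord_bounds(2) compatibleD(1)[OF assms(1)] c in blast)
qed

text \<open>
  Compare the nested chords of \<open>S\<close> and of \<open>S'\<close> that span the first column of \<open>c\<close>.  By
  \<open>compatible_same_depth\<close> they agree at every depth that occurs in both sets.  If the depth of \<open>d\<close> in
  \<open>S'\<close> occurs in \<open>S\<close>, this gives \<open>d \<in> S\<close>.  Otherwise \<open>S'\<close> goes deeper than \<open>S\<close>, so \<open>c\<close> occurs
  in \<open>S'\<close> too, above \<open>d\<close>, although \<open>d\<close> encloses \<open>c\<close>.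

  It follows that the depth of a chord, and with it its tile, does not depend on the compatible set;
  the lemmas below draw the consequences for unions, intersections and subsets.
\<close>

lemma compatible_enclosing_mem:
  assumes S: "compatible S" and S': "compatible S'" and c: "c \<in> S" and d: "d \<in> enclosing S' c"
  shows "d \<in> S"
proof -
  note B = compatibleD(1)[OF S] compatibleD(1)[OF S']
  have "fst c < snd c" using chord_bounds(2) B c by blast
  then have col: "c \<in> spanning S (fst c)" "d \<in> spanning S' (fst c)"
    using c d by (auto simp: spanning_def enclosing_def)
  show ?thesis
  proof (cases "card (enclosing S' d) < card (spanning S (fst c))")
    case True
    then obtain e where e: "e \<in> spanning S (fst c)" "card (enclosing S e) = card (enclosing S' d)"
      by (rule depth_ex[OF u B(1)])
    then have "e = d" by (rule compatible_same_depth[OF S S' _ col(2)])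
    then show ?thesis using e by (simp add: spanning_def)
  next
    case False
    have less: "card (enclosing S c) < card (enclosing S' d)"
      using depth_less[OF u B(1) col(1)] False by simp
    then have "card (enclosing S c) < card (spanning S' (fst c))"
      using depth_less[OF u B(2) col(2)] by simp
    then obtain e where e: "e \<in> spanning S' (fst c)" "card (enclosing S' e) = card (enclosing S c)"
      by (rule depth_ex[OF u B(2)])
    then have "e = c" using compatible_same_depth[OF S S' col(1) e(1)] by simp
    then have "card (enclosing S' d) < card (enclosing S c)"
      using depth_strict[OF B(2) d] e by simp
    then show ?thesis using less by simp
  qed
qed

lemma chord_tile_union:
  assumes "compatible S" "compatible S'" "c \<in> S"
  shows "chord_tile u (S \<union> S') c = chord_tile u S c"
  by (rule chord_tile_cong) (use compatible_enclosing_mem[OF assms] in \<open>auto simp: enclosing_def\<close>)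

lemma chord_tile_inter:
  assumes "compatible S" "compatible S'" "c \<in> S'"
  shows "chord_tile u (S \<inter> S') c = chord_tile u S c"
  by (rule chord_tile_cong)
    (use compatible_enclosing_mem[OF assms(2,1,3)] in \<open>auto simp: enclosing_def\<close>)

lemma chord_tile_subset:
  assumes "compatible S" "compatible S'" "S \<subseteq> S'" "c \<in> S"
  shows "chord_tile u S' c = chord_tile u S c"
  using chord_tile_union[OF assms(1,2,4)] assms(3) by (simp add: Un_absorb1)

lemma compatible_union:
  assumes S: "compatible S" and S': "compatible S'"
  shows "compatible (S \<union> S')"
proof -
  have "chord_tile u (S \<union> S') c \<in> \<T>" if "c \<in> S \<union> S'" for c
  proof (cases "c \<in> S")
    case True
    then show ?thesis using chord_tile_union[OF S S'] compatibleD(2)[OF S] by simp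
  next
    case False
    then have "c \<in> S'" using that by simp
    then show ?thesis
      using chord_tile_union[OF S' S] compatibleD(2)[OF S'] by (simp add: Un_commute)
  qed
  then show ?thesis using compatibleD(1)[OF S] compatibleD(1)[OF S'] by (auto simp: compatible_def)
qed

lemma compatible_inter:
  assumes S: "compatible S" and S': "compatible S'"
  shows "compatible (S \<inter> S')"
proof -
  have "chord_tile u (S \<inter> S') c \<in> \<T>" if "c \<in> S \<inter> S'" for c
    using that chord_tile_inter[OF S S'] compatibleD(2)[OF S] by simp
  then show ?thesis using compatibleD(1)[OF S] by (auto simp: compatible_def)
qed

lemma rest_antimono:
  assumes "compatible S" "compatible S'" "S \<subseteq> S'"
  shows "rest S' \<subseteq> rest S"
proof -
  have "chord_tile u S ` S = chord_tile u S' ` S"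
    using chord_tile_subset[OF assms] by (intro image_cong) simp_all
  then show ?thesis using assms(3) by (auto simp: rest_def)
qed

lemma cover_inclusive_subset: "cover_inclusive A \<Longrightarrow> B \<subseteq> A \<Longrightarrow> cover_inclusive B"
  unfolding cover_inclusive_def by blast

lemma admissible_superset:
  assumes "admissible S" "compatible S'" "S \<subseteq> S'"
  shows "admissible S'"
  using assms cover_inclusive_subset[OF _ rest_antimono[OF _ assms(2,3)]]
  by (simp add: admissible_def)

text \<open>
  The boxes of \<open>S\<close> fill each column from the top without gaps.
\<close>

lemma covers_chord_tile:
  assumes S: "compatible S" and c: "c \<in> S" and X: "X \<in> \<T>" and cov: "covers X (chord_tile u S c)"
  shows "X \<in> chord_tile u S ` S"
proof -
  note S' = compatibleD(1)[OF S]
  obtain i j where ij: "(i, j) \<in> X" "u i - 1 - 2 * int (card (enclosing S c)) < j"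
    and col: "c \<in> spanning S i"
    using cov c by (auto simp: covers_def mem_chord_tile spanning_def)
  note b = box_bounds[OF X ij(1)]
  have "push_down u S i < j"
    using depth_less[OF u S' col] push_down_spanning[OF S' b(1)] ij(2) by simp
  then have "(i, j) \<in> \<Union> (chord_tile u S ` S)"
    using b unfolding Union_chord_tiles[OF u S'] by (simp add: skew_boxes_def)
  then show ?thesis using tile_unique[OF X] ij(1) compatibleD(2)[OF S] by blast
qed

lemma rest_inter:
  assumes S: "compatible S" and S': "compatible S'"
  shows "rest (S \<inter> S') = rest S \<union> rest S'"
proof -
  have "chord_tile u (S \<inter> S') ` (S \<inter> S') = chord_tile u S ` S \<inter> chord_tile u S' ` S'"
  proof (intro equalityI subsetI)
    fix X assume "X \<in> chord_tile u (S \<inter> S') ` (S \<inter> S')"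
    then show "X \<in> chord_tile u S ` S \<inter> chord_tile u S' ` S'"
      using chord_tile_inter[OF S S'] chord_tile_inter[OF S' S] by (force simp: Int_commute)
  next
    fix X assume "X \<in> chord_tile u S ` S \<inter> chord_tile u S' ` S'"
    then obtain c d where c: "c \<in> S" "X = chord_tile u S c" and d: "d \<in> S'" "X = chord_tile u S' d"
      by auto
    then have "chord_tile u S c = chord_tile u S' d" by simp
    then have "c = d"
      by (rule chord_tile_inject) (use chord_bounds(2) compatibleD(1)[OF S] c in blast)
    then show "X \<in> chord_tile u (S \<inter> S') ` (S \<inter> S')"
      using c d chord_tile_inter[OF S S'] by auto
  qed
  then show ?thesis by (auto simp: rest_def)
qed

text \<open>
  A pair of tiles that violates cover-inclusion for the intersection has its upper tile \<open>X\<close> in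
  \<open>rest A\<close>, for \<open>A\<close> one of the two sets, and its lower tile \<open>Y\<close> outside of \<open>rest A\<close>.  But
  then \<open>Y\<close> is a tile of the chord set \<open>A\<close>, hence so is \<open>X\<close>, which lies above it.
\<close>

lemma admissible_inter:
  assumes S: "admissible S" and S': "admissible S'"
  shows "admissible (S \<inter> S')"
proof -
  have *: "horizontal_extent X \<subseteq> horizontal_extent Y"
    if A: "admissible A" and B: "admissible B"
      and X: "X \<in> rest A" and Y: "Y \<in> rest A \<union> rest B" "covers X Y" for A B X Y
  proof (cases "Y \<in> rest A")
    case True
    then show ?thesis using A X Y by (auto simp: admissible_def cover_inclusive_def)
  next
    case False
    then have "Y \<in> chord_tile u A ` A" using Y by (auto simp: rest_def)
    then have "X \<in> chord_tile u A ` A"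
      using covers_chord_tile[of A _ X] A X Y by (auto simp: admissible_def rest_def)
    then show ?thesis using X by (simp add: rest_def)
  qed
  have "cover_inclusive (rest S \<union> rest S')"
    using *[OF S S'] *[OF S' S] unfolding cover_inclusive_def by blast
  then show ?thesis
    using S S' compatible_inter rest_inter by (simp add: admissible_def)
qed

lemma compatible_remove:
  assumes S: "compatible S" and c: "c \<in> S" and leaf: "\<And>d. d \<in> S \<Longrightarrow> c \<notin> enclosing S d"
  shows "compatible (S - {c})" "rest (S - {c}) = insert (chord_tile u S c) (rest S)"
proof -
  have eq: "chord_tile u (S - {c}) d = chord_tile u S d" if "d \<in> S" for d
    by (rule chord_tile_cong) (use leaf[OF that] in \<open>auto simp: enclosing_def\<close>)
  then show "compatible (S - {c})" using S by (auto simp: compatible_def)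
  have "inj_on (chord_tile u S) S"
    using chord_tile_inject chord_bounds(2) compatibleD(1)[OF S] by (meson inj_onI subsetD)
  then show "rest (S - {c}) = insert (chord_tile u S c) (rest S)"
    using eq c compatibleD(2)[OF S c] by (auto simp: rest_def inj_on_def)
qed

lemma least_admissible:
  assumes "admissible S\<^sub>0"
  obtains V where "admissible V" "\<forall>S. admissible S \<longrightarrow> V \<subseteq> S"
proof -
  obtain V where V: "admissible V" "\<And>S. admissible S \<Longrightarrow> card V \<le> card S"
    using assms by (metis ex_has_least_nat)
  have "V \<subseteq> S" if "admissible S" for S
  proof -
    have "finite V"
      using V(1) finite_subset[OF _ finite_chords] by (auto simp: admissible_def compatible_def)
    moreover have "card V \<le> card (V \<inter> S)" by (rule V(2)[OF admissible_inter[OF V(1) that]])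
    ultimately show ?thesis by (metis card_seteq inf.cobounded1 inf.orderI)
  qed
  then show thesis using that V(1) by blast
qed

text \<open>
  The interval and the tile to which \<open>boundary_tile\<close> will be applied.  If \<open>V\<close> is empty, take the
  whole range, which no tile fills because \<open>l\<close> and \<open>u\<close> meet at the ends.  Otherwise take the columns
  of the chord \<open>c\<close> of \<open>V\<close> with the rightmost left end.  It is innermost, so \<open>V - {c}\<close> is
  compatible but, as \<open>V\<close> is least, not admissible, and the tile of \<open>c\<close> must be the upper one in a
  violation of cover-inclusion.
\<close>

lemma obstruction_interval:
  assumes V: "admissible V" and least: "\<And>S. admissible S \<Longrightarrow> V \<subseteq> S" and "\<T> \<noteq> {}"
  obtains p q X A where "0 \<le> p" "q \<le> 2 * int n" "\<forall>i\<in>{p..q}. spanning V i = A"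
    "u p = u q" "\<forall>i\<in>{p..q}. u p \<le> u i" "\<forall>c\<in>V. fst c \<le> p"
    "X \<in> rest V" "horizontal_extent X \<inter> {p..q} \<noteq> {}" "\<not> {p..q} \<subseteq> horizontal_extent X"
proof (cases "V = {}")
  case True
  obtain X where X: "X \<in> \<T>" using \<open>\<T> \<noteq> {}\<close> by blast
  obtain a e g where g: "tile_graph X a e g" by (rule graph_ex[OF X])
  then have "a \<le> e" by (simp add: tile_graph_def)
  then have m: "(a, g a) \<in> X" using mem_tile_graph[OF g] by simp
  note b = box_bounds[OF X m]
  have "a \<noteq> 0" using b l u by (auto simp: dyck_path_def)
  show thesis
  proof (rule that[of 0 "2 * int n" "{}" X])
    show "\<not> {0..2 * int n} \<subseteq> horizontal_extent X"
      using \<open>a \<noteq> 0\<close> b(1,2) by (auto simp: extent_tile_graph[OF g])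
    show "horizontal_extent X \<inter> {0..2 * int n} \<noteq> {}"
      using b(1,2) \<open>a \<le> e\<close> by (auto simp: extent_tile_graph[OF g])
  qed (use True X u in \<open>auto simp: spanning_def rest_def dyck_path_def\<close>)
next
  case False
  have comp: "compatible V" using V by (simp add: admissible_def)
  note Vc = compatibleD(1)[OF comp]
  have "finite V" using finite_subset[OF Vc finite_chords] .
  then have "Max (fst ` V) \<in> fst ` V" using False by simp
  then obtain c where c: "c \<in> V" "fst c = Max (fst ` V)" by force
  have max: "fst d \<le> fst c" if "d \<in> V" for d using c that \<open>finite V\<close> by simp
  have cc: "c \<in> chords n u" using c Vc by blast
  note b = chord_bounds[OF cc]
  have leaf: "c \<notin> enclosing V d" if "d \<in> V" for d using max[OF that] by (simp add: enclosing_def)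
  note rem = compatible_remove[OF comp c(1) leaf]
  have "\<not> admissible (V - {c})" using least[of "V - {c}"] c(1) by blast
  then have "\<not> cover_inclusive (insert (chord_tile u V c) (rest V))"
    using rem by (auto simp: admissible_def)
  then obtain X Y where XY: "X \<in> insert (chord_tile u V c) (rest V)"
    "Y \<in> insert (chord_tile u V c) (rest V)" "covers X Y"
    "\<not> horizontal_extent X \<subseteq> horizontal_extent Y"
    by (auto simp: cover_inclusive_def)
  \<comment> \<open>A tile of \<open>rest V\<close> cannot cover the tile of \<open>c\<close>, by \<open>covers_chord_tile\<close>, and there are no
    violations within \<open>rest V\<close>.\<close>
  have X: "X = chord_tile u V c"
  proof (rule ccontr)
    assume "X \<noteq> chord_tile u V c"
    then have X: "X \<in> rest V" using XY by auto
    then have "Y \<notin> rest V" using XY V by (auto simp: admissible_def cover_inclusive_def)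
    then have "covers X (chord_tile u V c)" using XY by auto
    then have "X \<in> chord_tile u V ` V"
      using covers_chord_tile[OF comp c(1)] X by (auto simp: rest_def)
    then show False using X by (simp add: rest_def)
  qed
  then have Y: "Y \<in> rest V" using XY by (auto simp: covers_def)
  have uc: "u (snd c - 1) = u (fst c)" "u (fst c) = u (fst c - 1) + 1"
    using cc by (auto simp: chords_def)
  have col: "spanning V i = spanning V (fst c)" if "fst c \<le> i" "i \<le> snd c - 1" for i
  proof -
    have "i < snd d" if "d \<in> V" "fst c < snd d" for d
    proof (cases "fst d = fst c")
      case True
      then have "d = c" using inj_onD[OF inj_on_fst_chords] that(1) cc Vc by blast
      then show ?thesis using \<open>i \<le> snd c - 1\<close> by simp
    next
      case False
      then have "snd c < snd d"
        using max[OF that(1)] that Vc by (intro chords_nested[OF u _ cc]) auto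
      then show ?thesis using \<open>i \<le> snd c - 1\<close> by simp
    qed
    then show ?thesis using max that by (force simp: spanning_def)
  qed
  show thesis
  proof (rule that[of "fst c" "snd c - 1" "spanning V (fst c)" Y])
    show "\<forall>i\<in>{fst c..snd c - 1}. u (fst c) \<le> u i"
      using chord_above[OF u cc] uc by fastforce
    show "horizontal_extent Y \<inter> {fst c..snd c - 1} \<noteq> {}"
      using XY(3) by (force simp: covers_def X mem_chord_tile horizontal_extent_def)
    show "\<not> {fst c..snd c - 1} \<subseteq> horizontal_extent Y"
      using XY(4) by (simp add: X extent_chord_tile)
    show "\<forall>i\<in>{fst c..snd c - 1}. spanning V i = spanning V (fst c)"
      by (intro ballI col) simp_all
  qed (use b Y uc max in auto)
qed

text \<open>
  The chord is the one found by \<open>boundary_tile\<close> below the least admissible set \<open>V\<close>.  An admissible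
  \<open>S\<close> contains \<open>V\<close>, so \<open>insert c S\<close> is the union of the compatible sets \<open>S\<close> and \<open>insert c V\<close>.
  Conversely \<open>S - {c}\<close> still contains \<open>V\<close>, and it is compatible because \<open>c\<close> encloses no chord of
  \<open>S\<close>.  Indeed, such a chord starts to the right of \<open>c\<close>, hence of all of \<open>V\<close>, so that it and \<open>c\<close>
  would both have their tiles in the cover-inclusive tiling \<open>rest V\<close>, with
  the longer tile covering the shorter one.
\<close>

lemma toggle_chord:
  assumes le: "path_le n l u" and "admissible S\<^sub>0" "\<T> \<noteq> {}"
  obtains c where "\<forall>S. admissible S \<longrightarrow> admissible (insert c S) \<and> admissible (S - {c})"
proof -
  obtain V where V: "admissible V" and V_least: "\<forall>S. admissible S \<longrightarrow> V \<subseteq> S"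
    by (rule least_admissible[OF \<open>admissible S\<^sub>0\<close>])
  have least: "V \<subseteq> S" if "admissible S" for S using V_least that by simp
  have comp: "compatible V" and ci: "cover_inclusive (rest V)"
    using V by (simp_all add: admissible_def)
  note Vc = compatibleD(1)[OF comp]
  obtain p q X A where pq: "0 \<le> p" "q \<le> 2 * int n"
    and A: "\<forall>i\<in>{p..q}. spanning V i = A"
    and val: "u p = u q" "\<forall>i\<in>{p..q}. u p \<le> u i"
    and left: "\<forall>c\<in>V. fst c \<le> p"
    and X: "X \<in> rest V" "horizontal_extent X \<inter> {p..q} \<noteq> {}" "\<not> {p..q} \<subseteq> horizontal_extent X"
    by (rule obstruction_interval[OF V least \<open>\<T> \<noteq> {}\<close>])
  let ?v = "push_down u V"
  have le': "path_le n l ?v" by (rule path_le_push_down[OF comp le])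
  have v: "?v i = u i - 2 * int (card A)" if "p \<le> i" "i \<le> q" for i
    using push_down_spanning[OF Vc, of i] A pq that by simp
  interpret R: skew_tiling n l ?v "rest V"
    by unfold_locales
      (rule l, rule dyck_path_push_down[OF u Vc l le'], rule dyck_tiling_rest[OF comp le])
  have "p \<le> q" using X(2) by auto
  obtain c where c: "c \<in> chords n ?v" "p < fst c" "snd c \<le> q"
    and tile: "(\<lambda>i. (i, ?v i - 1)) ` {fst c..snd c - 1} \<in> rest V"
    by (rule R.boundary_tile[OF ci pq _ _ X]) (use v val \<open>p \<le> q\<close> in auto)
  note b = chord_bounds[OF c(1)]
  \<comment> \<open>On the interval \<open>{p..q}\<close> the two paths differ by a constant, and \<open>fst c - 1\<close> is still in it.\<close>
  have cu: "c \<in> chords n u"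
    using c b v by (auto simp: chords_def)
  have enclosingV: "enclosing V c = A"
  proof (intro equalityI subsetI)
    fix d assume "d \<in> enclosing V c"
    then have "d \<in> spanning V (fst c)" using b by (auto simp: enclosing_def spanning_def)
    then show "d \<in> A" using A b c by simp
  next
    fix d assume d: "d \<in> A"
    then have "d \<in> spanning V (snd c)" using A b c by simp
    then show "d \<in> enclosing V c" using left d c by (auto simp: enclosing_def spanning_def)
  qed
  have inV: "chord_tile u (insert c V) d = chord_tile u V d" if "d \<in> V" for d
    by (rule chord_tile_cong) (use left that c in \<open>auto simp: enclosing_def\<close>)
  have "enclosing (insert c V) c = A" using enclosingV by (auto simp: enclosing_def)
  then have tile': "chord_tile u (insert c V) c = (\<lambda>i. (i, ?v i - 1)) ` {fst c..snd c - 1}"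
    using v c(2,3) by (auto simp: mem_chord_tile image_iff simp del: split_paired_All split_paired_Ex)
  have W: "compatible (insert c V)"
    using comp cu inV tile tile' by (auto simp: compatible_def rest_def)
  have cV: "c \<notin> V" using left c by auto
  have "admissible (insert c S)" if S: "admissible S" for S
  proof -
    have "compatible (S \<union> insert c V)"
      by (rule compatible_union[OF _ W]) (use S in \<open>simp add: admissible_def\<close>)
    moreover have "S \<union> insert c V = insert c S" using least[OF S] by auto
    ultimately show ?thesis using admissible_superset[OF S] by auto
  qed
  moreover have "admissible (S - {c})" if S: "admissible S" for S
  proof (cases "c \<in> S")
    case True
    have Sc: "compatible S" using S by (simp add: admissible_def)
    have notV: "chord_tile u S d \<in> rest V" if "d \<in> S" "d \<notin> V" for d
    proof -
      have "chord_tile u S d \<noteq> chord_tile u V e" if "e \<in> V" for e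
      proof
        assume "chord_tile u S d = chord_tile u V e"
        then have "d = e"
          by (rule chord_tile_inject)
            (use chord_bounds(2) compatibleD(1)[OF Sc] \<open>d \<in> S\<close> in blast)
        then show False using \<open>d \<notin> V\<close> that by simp
      qed
      then show ?thesis using compatibleD(2)[OF Sc that(1)] by (auto simp: rest_def)
    qed
    have leaf: "c \<notin> enclosing S d" if d: "d \<in> S" for d
    proof
      assume cd: "c \<in> enclosing S d"
      then have lt: "fst c < fst d" "snd d < snd c" by (auto simp: enclosing_def)
      then have "d \<notin> V" using left d c by auto
      have "fst d < snd d" using chord_bounds(2) compatibleD(1)[OF Sc] d by blast
      have "(fst d, u (fst d) - 1 - 2 * int (card (enclosing S c))) \<in> chord_tile u S c"
        "(fst d, u (fst d) - 1 - 2 * int (card (enclosing S d))) \<in> chord_tile u S d"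
        using lt \<open>fst d < snd d\<close> by (auto simp: mem_chord_tile)
      moreover have "card (enclosing S c) < card (enclosing S d)"
        by (rule depth_strict[OF compatibleD(1)[OF Sc] cd])
      moreover have "chord_tile u S c \<noteq> chord_tile u S d"
        using chord_tile_inject[of u S c S d] b lt by auto
      ultimately have "covers (chord_tile u S c) (chord_tile u S d)"
        unfolding covers_def by force
      then have "horizontal_extent (chord_tile u S c) \<subseteq> horizontal_extent (chord_tile u S d)"
        using ci notV[OF True cV] notV[OF d \<open>d \<notin> V\<close>]
        unfolding cover_inclusive_def by blast
      then show False using lt b by (simp add: extent_chord_tile)
    qed
    have "compatible (S - {c})" by (rule compatible_remove(1)[OF Sc True leaf])
    then show ?thesis using admissible_superset[OF V] least[OF S] cV by blast
  qed (use S in simp)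
  ultimately show thesis using that by blast
qed

end

section \<open>Cancellation\<close>

lemma sum_signed_toggle:
  assumes "finite F" and closed: "\<And>S. S \<in> F \<Longrightarrow> insert c S \<in> F \<and> S - {c} \<in> F"
    and fin: "\<And>S. S \<in> F \<Longrightarrow> finite S"
  shows "(\<Sum>S\<in>F. (- 1) ^ card S) = (0 :: int)"
proof -
  define t where "t S = (if c \<in> S then S - {c} else insert c S)" for S
  have t: "t S \<in> F" "t (t S) = S" if "S \<in> F" for S
    using closed[OF that] by (auto simp: t_def)
  have "(- 1) ^ card (t S) = - ((- 1) ^ card S :: int)" if "S \<in> F" for S
  proof (cases "c \<in> S")
    case True
    then have "card S = Suc (card (t S))"
      using card_Suc_Diff1[OF fin[OF that] True] by (simp add: t_def)
    then show ?thesis by simp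
  next
    case False
    then show ?thesis using fin[OF that] by (simp add: t_def)
  qed
  then have "(\<Sum>S\<in>F. (- 1) ^ card S) = (\<Sum>S\<in>F. - ((- 1) ^ card S :: int))"
    by (intro sum.reindex_bij_witness[of _ t t]) (auto simp: t)
  then show ?thesis by (simp add: sum_negf)
qed

context skew_tiling
begin

text \<open>
  The signs of all admissible sets add up to \<open>0\<close>; leaving out the empty set, which has the sign \<open>1\<close>,
  and negating the rest leaves \<open>1\<close> if the empty set is admissible and \<open>0\<close> otherwise.
\<close>

lemma signed_sum_admissible:
  assumes le: "path_le n l u" and "\<T> \<noteq> {}"
  shows "(\<Sum>S | S \<subseteq> chords n u \<and> S \<noteq> {} \<and> admissible S. (- 1) ^ (1 + card S))
    = (if cover_inclusive \<T> then 1 else 0 :: int)"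
proof -
  define F where "F = {S. admissible S}"
  have sub: "S \<subseteq> chords n u" if "admissible S" for S
    using that by (simp add: admissible_def compatible_def)
  have "F \<subseteq> Pow (chords n u)" using sub by (auto simp: F_def)
  then have fin: "finite F" using finite_chords finite_subset by blast
  have empty: "{} \<in> F \<longleftrightarrow> cover_inclusive \<T>"
    by (simp add: F_def admissible_def compatible_def rest_def)
  have zero: "(\<Sum>S\<in>F. (- 1) ^ card S) = (0 :: int)"
  proof (cases "F = {}")
    case False
    then obtain S\<^sub>0 where "admissible S\<^sub>0" by (auto simp: F_def)
    then obtain c where
      c: "\<forall>S. admissible S \<longrightarrow> admissible (insert c S) \<and> admissible (S - {c})"
      by (rule toggle_chord[OF le _ \<open>\<T> \<noteq> {}\<close>])
    show ?thesis
      by (rule sum_signed_toggle[OF fin, of c])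
        (use c finite_subset[OF sub finite_chords] in \<open>auto simp: F_def\<close>)
  qed simp
  have "{S. S \<subseteq> chords n u \<and> S \<noteq> {} \<and> admissible S} = F - {{}}"
    using sub by (auto simp: F_def)
  then have "(\<Sum>S | S \<subseteq> chords n u \<and> S \<noteq> {} \<and> admissible S. (- 1) ^ (1 + card S))
      = - (\<Sum>S\<in>F - {{}}. (- 1) ^ card S :: int)"
    by (simp add: sum_negf)
  also have "\<dots> = (if cover_inclusive \<T> then 1 else 0)"
    using zero fin empty by (simp add: sum_diff1)
  finally show ?thesis .
qed

end

section \<open>Evaluation of the recursion\<close>

lemma frag_cmul_sum_left: "frag_cmul (\<Sum>i\<in>I. f i) a = (\<Sum>i\<in>I. frag_cmul (f i) a)"
  by (induction I rule: infinite_finite_induct) (simp_all add: frag_cmul_distrib)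

text \<open>
  Adding the tiles of \<open>S\<close> is a bijection from the cover-inclusive tilings below \<open>push_down u S\<close> to
  the tilings of the whole region for which \<open>S\<close> is admissible; its inverse removes these tiles.  If
  \<open>push_down u S\<close> drops below \<open>l\<close>, then \<open>S\<close> is admissible for no tiling, which matches the value
  \<open>0\<close> of the recursion.
\<close>

lemma add_chord_tiles_sum:
  assumes l: "dyck_path n l" and u: "dyck_path n u" and le: "path_le n l u"
    and S: "S \<subseteq> chords n u"
    and f: "f = (if path_le n l (push_down u S)
      then \<Sum>\<T> | dyck_tiling n l (push_down u S) \<T> \<and> cover_inclusive \<T>. frag_of \<T> else 0)"
  shows "frag_extend (\<lambda>\<T>. frag_of (\<T> \<union> chord_tile u S ` S)) f
    = (\<Sum>\<T> | dyck_tiling n l u \<T> \<and> skew_tiling.admissible n u \<T> S. frag_of \<T>)"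
proof -
  let ?L = "{\<T>. dyck_tiling n l (push_down u S) \<T> \<and> cover_inclusive \<T>}"
  let ?R = "{\<T>. dyck_tiling n l u \<T> \<and> skew_tiling.admissible n u \<T> S}"
  have R: "chord_tile u S ` S \<subseteq> \<T>" "cover_inclusive (\<T> - chord_tile u S ` S)"
    "dyck_tiling n l (push_down u S) (\<T> - chord_tile u S ` S)"
    "path_le n l (push_down u S)" if "\<T> \<in> ?R" for \<T>
  proof -
    interpret skew_tiling n l u \<T> by unfold_locales (use that l u in auto)
    have S: "compatible S" "cover_inclusive (rest S)"
      using that by (simp_all add: admissible_def)
    then show "chord_tile u S ` S \<subseteq> \<T>" "cover_inclusive (\<T> - chord_tile u S ` S)"
      by (simp_all add: compatible_def rest_def)
    show "dyck_tiling n l (push_down u S) (\<T> - chord_tile u S ` S)"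
      using dyck_tiling_rest[OF S(1) le] by (simp add: rest_def)
    show "path_le n l (push_down u S)" by (rule path_le_push_down[OF S(1) le])
  qed
  show ?thesis
  proof (cases "path_le n l (push_down u S)")
    case True
    have L: "\<T> \<union> chord_tile u S ` S \<in> ?R" "\<T> \<inter> chord_tile u S ` S = {}" if "\<T> \<in> ?L" for \<T>
    proof -
      have T: "dyck_tiling n l (push_down u S) \<T>" using that by simp
      note add = dyck_tiling_add_chord_tiles[OF u S True T]
      interpret skew_tiling n l u "\<T> \<union> chord_tile u S ` S"
        by unfold_locales (rule l, rule u, rule add(1))
      have "rest S = \<T>" using add(2) by (auto simp: rest_def)
      then show "\<T> \<union> chord_tile u S ` S \<in> ?R"
        using add(1) S that by (simp add: admissible_def compatible_def)
      show "\<T> \<inter> chord_tile u S ` S = {}" by (rule add(2))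
    qed
    have "finite ?L" by (rule finite_subset[OF _ finite_dyck_tilings[of n l "push_down u S"]]) auto
    then have "frag_extend (\<lambda>\<T>. frag_of (\<T> \<union> chord_tile u S ` S)) f
        = (\<Sum>\<T>\<in>?L. frag_of (\<T> \<union> chord_tile u S ` S))"
      using True f by (simp add: frag_extend_sum o_def)
    also have "\<dots> = (\<Sum>\<T>\<in>?R. frag_of \<T>)"
    proof (rule sum.reindex_bij_witness[of _ "\<lambda>\<T>. \<T> - chord_tile u S ` S"
          "\<lambda>\<T>. \<T> \<union> chord_tile u S ` S"])
      show "(\<T> \<union> chord_tile u S ` S) - chord_tile u S ` S = \<T>" if "\<T> \<in> ?L" for \<T>
        using L(2)[OF that] by blast
      show "\<T> \<union> chord_tile u S ` S \<in> ?R" if "\<T> \<in> ?L" for \<T>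
        by (rule L(1)[OF that])
      show "(\<T> - chord_tile u S ` S) \<union> chord_tile u S ` S = \<T>" if "\<T> \<in> ?R" for \<T>
        using R(1)[OF that] by blast
      show "\<T> - chord_tile u S ` S \<in> ?L" if "\<T> \<in> ?R" for \<T>
        using R[OF that] by simp
    qed simp
    finally show ?thesis .
  next
    case False
    then have "?R = {}" using R(4) by blast
    then show ?thesis using False f by (simp only: sum.empty) simp
  qed
qed

text \<open>
  Heights of two Dyck paths in the same column have the same parity, so where the paths differ there is
  room for a box.
\<close>

lemma skew_boxes_eq_empty_iff:
  assumes l: "dyck_path n l" and u: "dyck_path n u" and le: "path_le n l u"
  shows "skew_boxes n l u = {} \<longleftrightarrow> path_eq n l u"
proof
  assume empty: "skew_boxes n l u = {}"
  show "path_eq n l u"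
    unfolding path_eq_def
  proof
    fix i assume i: "i \<in> {0..2 * int n}"
    show "l i = u i"
    proof (rule ccontr)
      assume "l i \<noteq> u i"
      moreover have "even (u i + i)" "even (l i + i)" "l i \<le> u i"
        using dyck_path_parity[OF u, of i] dyck_path_parity[OF l, of i] i le
        by (auto simp: path_le_def)
      ultimately have "l i < u i - 1" "odd (i + (u i - 1))" by presburger+
      then have "(i, u i - 1) \<in> skew_boxes n l u" using i by (simp add: skew_boxes_def)
      then show False using empty by simp
    qed
  qed
next
  assume "path_eq n l u"
  then show "skew_boxes n l u = {}" by (auto simp: path_eq_def skew_boxes_def)
qed

theorem theorem1p6:
  fixes n :: nat and l u :: "int \<Rightarrow> int"
  assumes "dyck_path n l" and "dyck_path n u" and "path_le n l u"
  shows "tiling_sum n l u =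
    (\<Sum>\<T>\<in>{\<T>. dyck_tiling n l u \<T> \<and> cover_inclusive \<T>}. frag_of \<T>)"
  using assms
proof (induction n l u rule: tiling_sum.induct)
  case (1 n l u)
  note l = "1.prems"(1) and u = "1.prems"(2) and le = "1.prems"(3)
  show ?case
  proof (cases "path_eq n l u")
    case True
    then have "dyck_tiling n l u \<T> \<longleftrightarrow> \<T> = {}" for \<T>
      using skew_boxes_eq_empty_iff[OF l u le] by (auto simp: dyck_tiling_def partition_on_empty)
    then have "{\<T>. dyck_tiling n l u \<T> \<and> cover_inclusive \<T>} = {{}}"
      by (auto simp: cover_inclusive_def)
    then show ?thesis using True by (subst tiling_sum.simps) simp
  next
    case False
    let ?C = "{S. S \<subseteq> chords n u \<and> S \<noteq> {}}"
    let ?D = "{\<T>. dyck_tiling n l u \<T>}"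
    let ?adm = "\<lambda>\<T> S. skew_tiling.admissible n u \<T> S"
    have fin: "finite ?C" "finite ?D"
      using finite_chords[of n u] finite_dyck_tilings[of n l u] by auto
    have sub: "tiling_sum n l (push_down u S) = (if path_le n l (push_down u S)
        then \<Sum>\<T> | dyck_tiling n l (push_down u S) \<T> \<and> cover_inclusive \<T>. frag_of \<T> else 0)"
      if S: "S \<in> ?C" for S
    proof (cases "path_le n l (push_down u S)")
      case True
      have "dyck_path n (push_down u S)"
        by (rule dyck_path_push_down[OF u _ l True]) (use S in simp)
      then show ?thesis using "1.IH"[OF False _ S l _ True] le True by simp
    next
      case False
      then have "\<not> path_eq n l (push_down u S)" by (force simp: path_eq_def path_le_def)
      then show ?thesis using False by (subst tiling_sum.simps) simp
    qed
    have "tiling_sum n l u = (\<Sum>S\<in>?C. frag_cmul ((- 1) ^ (1 + card S))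
        (frag_extend (\<lambda>\<T>. frag_of (\<T> \<union> chord_tile u S ` S)) (tiling_sum n l (push_down u S))))"
      using False le by (subst tiling_sum.simps) simp
    also have "\<dots> = (\<Sum>S\<in>?C. frag_cmul ((- 1) ^ (1 + card S))
        (\<Sum>\<T> | dyck_tiling n l u \<T> \<and> ?adm \<T> S. frag_of \<T>))"
    proof (rule sum.cong[OF refl])
      fix S assume S: "S \<in> ?C"
      then show "frag_cmul ((- 1) ^ (1 + card S))
          (frag_extend (\<lambda>\<T>. frag_of (\<T> \<union> chord_tile u S ` S)) (tiling_sum n l (push_down u S)))
        = frag_cmul ((- 1) ^ (1 + card S))
          (\<Sum>\<T> | dyck_tiling n l u \<T> \<and> ?adm \<T> S. frag_of \<T>)"
        using add_chord_tiles_sum[OF l u le _ sub[OF S]] by simp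
    qed
    also have "\<dots> = (\<Sum>S\<in>?C. \<Sum>\<T>\<in>?D.
        frag_cmul (if ?adm \<T> S then (- 1) ^ (1 + card S) else 0) (frag_of \<T>))"
    proof (rule sum.cong[OF refl])
      fix S
      have "{\<T>. dyck_tiling n l u \<T> \<and> ?adm \<T> S} = {\<T> \<in> ?D. ?adm \<T> S}" by simp
      then show "frag_cmul ((- 1) ^ (1 + card S))
          (\<Sum>\<T> | dyck_tiling n l u \<T> \<and> ?adm \<T> S. frag_of \<T>)
        = (\<Sum>\<T>\<in>?D. frag_cmul (if ?adm \<T> S then (- 1) ^ (1 + card S) else 0) (frag_of \<T>))"
        by (simp only: sum.inter_filter[OF fin(2)] frag_cmul_sum) (rule sum.cong, auto)
    qed
    also have "\<dots> = (\<Sum>\<T>\<in>?D. frag_cmul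
        (\<Sum>S\<in>?C. if ?adm \<T> S then (- 1) ^ (1 + card S) else 0) (frag_of \<T>))"
      by (subst sum.swap) (simp only: frag_cmul_sum_left)
    also have "\<dots> = (\<Sum>\<T>\<in>?D. if cover_inclusive \<T> then frag_of \<T> else 0)"
    proof (rule sum.cong[OF refl])
      fix \<T> assume T: "\<T> \<in> ?D"
      interpret skew_tiling n l u \<T> by unfold_locales (use T l u in auto)
      have "\<T> \<noteq> {}"
        using T False skew_boxes_eq_empty_iff[OF l u le]
        by (auto simp: dyck_tiling_def partition_on_def)
      then have "(\<Sum>S\<in>?C. if admissible S then (- 1) ^ (1 + card S) else 0)
          = (if cover_inclusive \<T> then 1 else 0 :: int)"
        using signed_sum_admissible[OF le]
        by (simp only: sum.inter_filter[OF fin(1), symmetric]) (simp add: conj_assoc)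
      then show "frag_cmul (\<Sum>S\<in>?C. if admissible S then (- 1) ^ (1 + card S) else 0) (frag_of \<T>)
          = (if cover_inclusive \<T> then frag_of \<T> else 0)"
        by simp
    qed
    also have "\<dots> = (\<Sum>\<T>\<in>{\<T>. dyck_tiling n l u \<T> \<and> cover_inclusive \<T>}. frag_of \<T>)"
      by (simp add: sum.inter_filter[OF fin(2), symmetric])
    finally show ?thesis .
  qed
qed

end
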